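(* For all order functions $p_1\colon \mathbb{N} \to (1,\infty)$ and $p_2\colon \mathbb{N} \to (1,\infty)$, there exists a slow-growing order function $q\colon \mathbb{N} \to (1,\infty)$ such that $\mathrm{LUA}(p_1) \not\leq_{\mathrm{w}} \mathrm{LUA}(q)$ and $\mathrm{LUA}(q)\not\leq_{\mathrm{w}} \mathrm{LUA}(p_2)$. In particular, for any order function $p\colon \mathbb{N} \to (1,\infty)$, there exists a slow-growing order function $q\colon \mathbb{N} \to (1,\infty)$ such that $\mathrm{LUA}(p)$ and $\mathrm{LUA}(q)$ are weakly incomparable (neither is $\leq_{\mathrm{w}}$ the other).
   Context: An order function is a computable (i.e. its values are uniformly computable reals), nondecreasing, unbounded function $\mathbb{N}\to\mathbb{R}$. An order function $q\colon\mathbb{N}\to(1,\infty)$ is slow-growing if $\sum_{n=0}^\infty q(n)^{-1}=\infty$. A partial recursive $\psi\colon\subseteq\mathbb{N}\to\mathbb{N}$ is linearly universal if for every partial recursive $\theta\colon\subseteq\mathbb{N}\to\mathbb{N}$ there are $a,b\in\mathbb{N}$ with $\psi(ax+b)\simeq\theta(x)$ for all $x$. For $p\colon\mathbb{N}\to(1,\infty)$, $\mathrm{LUA}(p)$ is the set of $X\in\mathbb{N}^{\mathbb{N}}$ such that $X(n)<p(n)$ for all $n$ and, for some linearly universal partial recursive $\psi$, there is no $n\in\operatorname{dom}\psi$ with $X(n)=\psi(n)$. For $P,Q\subseteq\mathbb{N}^{\mathbb{N}}$, $P\leq_{\mathrm{w}}Q$ means every $Y\in Q$ Turing-computes some $X\in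 P$. *)

theory Defs
  imports Complex_Main "HOL-Library.Nat_Bijection" "HOL-Library.Countable"
begin

text \<open>
  Kleene's schemes for partial functions on the naturals, relative to a set \<open>A\<close> of total
  oracles. Functions of several arguments are represented by unary functions on tuples coded
  with \<^const>\<open>prod_encode\<close>. Undefinedness is \<^const>\<open>None\<close>.
\<close>

definition minimization :: "(nat \<rightharpoonup> nat) \<Rightarrow> nat option" where
  "minimization h =
     (if \<exists>i. h i = Some 0 \<and> (\<forall>j<i. h j \<noteq> None) then Some (LEAST i. h i = Some 0) else None)"

inductive partial_recursive_in :: "(nat \<Rightarrow> nat) set \<Rightarrow> (nat \<rightharpoonup> nat) \<Rightarrow> bool"
  for A :: "(nat \<Rightarrow> nat) set" where
  zero: "partial_recursive_in A (\<lambda>n. Some 0)"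
| succ: "partial_recursive_in A (\<lambda>n. Some (Suc n))"
| left: "partial_recursive_in A (\<lambda>n. Some (fst (prod_decode n)))"
| right: "partial_recursive_in A (\<lambda>n. Some (snd (prod_decode n)))"
| query: "X \<in> A \<Longrightarrow> partial_recursive_in A (\<lambda>n. Some (X n))"
| pair: "partial_recursive_in A f \<Longrightarrow> partial_recursive_in A g \<Longrightarrow>
    partial_recursive_in A
      (\<lambda>n. Option.bind (f n) (\<lambda>a. Option.bind (g n) (\<lambda>b. Some (prod_encode (a, b)))))"
| comp: "partial_recursive_in A f \<Longrightarrow> partial_recursive_in A g \<Longrightarrow>
    partial_recursive_in A (\<lambda>n. Option.bind (g n) f)"
| prim_rec: "partial_recursive_in A f \<Longrightarrow> partial_recursive_in A g \<Longrightarrow>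
    partial_recursive_in A
      (\<lambda>n. case prod_decode n of (x, k) \<Rightarrow>
         rec_nat (f x)
           (\<lambda>i r. Option.bind r (\<lambda>v. g (prod_encode (x, prod_encode (i, v))))) k)"
| mu: "partial_recursive_in A f \<Longrightarrow>
    partial_recursive_in A (\<lambda>x. minimization (\<lambda>i. f (prod_encode (x, i))))"

definition partial_recursive :: "(nat \<rightharpoonup> nat) \<Rightarrow> bool" where
  "partial_recursive \<psi> \<longleftrightarrow> partial_recursive_in {} \<psi>"

definition total_recursive :: "(nat \<Rightarrow> nat) \<Rightarrow> bool" where
  "total_recursive f \<longleftrightarrow> partial_recursive (\<lambda>n. Some (f n))"

definition turing_computes :: "(nat \<Rightarrow> nat) \<Rightarrow> (nat \<Rightarrow> nat) \<Rightarrow> bool" where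
  "turing_computes Y X \<longleftrightarrow> partial_recursive_in {Y} (\<lambda>n. Some (X n))"

text \<open>
  The values of \<open>p\<close> are uniformly computable reals: from \<open>n\<close> and \<open>k\<close> one can compute (the code,
  under the effective surjection \<^const>\<open>nat_to_rat_surj\<close>, of) a rational within \<open>1 / 2 ^ k\<close> of \<open>p n\<close>.
\<close>

definition computable_real_function :: "(nat \<Rightarrow> real) \<Rightarrow> bool" where
  "computable_real_function p \<longleftrightarrow>
     (\<exists>f. total_recursive f \<and>
        (\<forall>n k. \<bar>p n - of_rat (nat_to_rat_surj (f (prod_encode (n, k))))\<bar> \<le> 1 / 2 ^ k))"

definition order_function :: "(nat \<Rightarrow> real) \<Rightarrow> bool" where
  "order_function p \<longleftrightarrow> computable_real_function p \<and> mono p \<and> (\<forall>M. \<exists>n. M < p n)"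

definition slow_growing :: "(nat \<Rightarrow> real) \<Rightarrow> bool" where
  "slow_growing q \<longleftrightarrow> filterlim (\<lambda>N. \<Sum>n<N. inverse (q n)) at_top sequentially"

definition linearly_universal :: "(nat \<rightharpoonup> nat) \<Rightarrow> bool" where
  "linearly_universal \<psi> \<longleftrightarrow> partial_recursive \<psi> \<and>
     (\<forall>\<theta>. partial_recursive \<theta> \<longrightarrow> (\<exists>a b. \<forall>x. \<psi> (a * x + b) = \<theta> x))"

definition LUA :: "(nat \<Rightarrow> real) \<Rightarrow> (nat \<Rightarrow> nat) set" where
  "LUA p = {X. (\<forall>n. real (X n) < p n) \<and>
     (\<exists>\<psi>. linearly_universal \<psi> \<and> \<not> (\<exists>n\<in>dom \<psi>. \<psi> n = Some (X n)))}"

definition weakly_reducible :: "(nat \<Rightarrow> nat) set \<Rightarrow> (nat \<Rightarrow> nat) set \<Rightarrow> bool"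
    (infix "\<le>\<^sub>w" 50) where
  "P \<le>\<^sub>w Q \<longleftrightarrow> (\<forall>Y\<in>Q. \<exists>X\<in>P. turing_computes Y X)"

end

theory Submission
  imports Defs "HOL-Library.Sublist"
begin

text \<open>
  The function \<open>q\<close> is a step function. Its jumps are so large, compared with \<open>p\<^sub>1\<close>, that forcing
  with bushy trees of \<open>q\<close>-bounded strings yields a member of \<open>LUA q\<close> computing no member of
  \<open>LUA p\<^sub>1\<close>; its plateaus are so long that \<open>q\<close> stays small until \<open>p\<^sub>2\<close> has grown far
  beyond it, so that forcing with \<open>p\<^sub>2\<close>-bounded strings yields a member of \<open>LUA p\<^sub>2\<close> computing no
  member of \<open>LUA q\<close>. Long plateaus also make \<open>\<Sum> 1 / q n\<close> diverge.

  For one functional, a condition is a string \<open>\<sigma>\<close> with a set \<open>B\<close> of forbidden strings that is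
  \<open>k\<close>-small above \<open>\<sigma>\<close>. If the strings on which the functional has an admissible value at a
  suitable argument form a small set, they are added to \<open>B\<close>. Otherwise, by pigeonhole, some single
  value is forced on a \<open>k\<close>-big set; one such value is found effectively from \<open>\<sigma>\<close> and \<open>k\<close>, so a
  partial recursive function, embedded in every linearly universal one, can agree with it.
\<close>

section \<open>Recursive functions and decidable predicates\<close>

abbreviation pair_code :: "nat \<Rightarrow> nat \<Rightarrow> nat"  ("\<langle>_,/ _\<rangle>") where
  "\<langle>a, b\<rangle> \<equiv> prod_encode (a, b)"

definition pfst :: "nat \<Rightarrow> nat" where "pfst n = fst (prod_decode n)"
definition psnd :: "nat \<Rightarrow> nat" where "psnd n = snd (prod_decode n)"

lemma pfst_pair [simp]: "pfst \<langle>a, b\<rangle> = a"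
  and psnd_pair [simp]: "psnd \<langle>a, b\<rangle> = b"
  and pair_pfst_psnd [simp]: "\<langle>pfst n, psnd n\<rangle> = n"
  by (simp_all add: pfst_def psnd_def)

lemma pair_cases: obtains a b where "n = \<langle>a, b\<rangle>"
  by (metis pair_pfst_psnd)

definition decidable :: "(nat \<Rightarrow> bool) \<Rightarrow> bool" where
  "decidable P \<longleftrightarrow> total_recursive (\<lambda>n. of_bool (P n))"

text \<open>Collects closure rules, so that \<open>intro rec_intros\<close> proves recursiveness and
  decidability along the syntax of a term.\<close>

named_theorems rec_intros

section \<open>Closure of the total recursive functions under composition, primitive recursion and
  arithmetic\<close>

lemma rec_comp: "total_recursive f \<Longrightarrow> total_recursive g \<Longrightarrow> total_recursive (\<lambda>n. f (g n))"
  unfolding total_recursive_def partial_recursive_def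
  by (drule (1) partial_recursive_in.comp) simp

lemma rec_Suc [rec_intros]: "total_recursive f \<Longrightarrow> total_recursive (\<lambda>n. Suc (f n))"
  by (rule rec_comp[of Suc])
    (auto simp: total_recursive_def partial_recursive_def intro: partial_recursive_in.succ)

lemma rec_const [rec_intros]: "total_recursive (\<lambda>n. c)"
proof (induction c)
  case 0
  show ?case
    by (auto simp: total_recursive_def partial_recursive_def intro: partial_recursive_in.zero)
qed (rule rec_Suc)

lemma rec_pfst [rec_intros]: "total_recursive f \<Longrightarrow> total_recursive (\<lambda>n. pfst (f n))"
  by (rule rec_comp[of pfst])
    (auto simp: pfst_def total_recursive_def partial_recursive_def intro: partial_recursive_in.left)

lemma rec_psnd [rec_intros]: "total_recursive f \<Longrightarrow> total_recursive (\<lambda>n. psnd (f n))"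
  by (rule rec_comp[of psnd])
    (auto simp: psnd_def total_recursive_def partial_recursive_def intro: partial_recursive_in.right)

lemma rec_pair [rec_intros]:
  "total_recursive f \<Longrightarrow> total_recursive g \<Longrightarrow> total_recursive (\<lambda>n. \<langle>f n, g n\<rangle>)"
  unfolding total_recursive_def partial_recursive_def
  by (drule (1) partial_recursive_in.pair) simp

text \<open>The identity is not among the schemes; it arises by pairing the two projections.\<close>

lemma rec_id [rec_intros]: "total_recursive (\<lambda>n. n)"
proof -
  have "total_recursive (\<lambda>n. fst (prod_decode n))" "total_recursive (\<lambda>n. snd (prod_decode n))"
    by (auto simp: total_recursive_def partial_recursive_def
        intro: partial_recursive_in.left partial_recursive_in.right)
  from rec_pair[OF this] show ?thesis by simp
qed

lemma rec_comp2:
  assumes "total_recursive (\<lambda>n. h (pfst n) (psnd n))" "total_recursive f" "total_recursive g"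
  shows "total_recursive (\<lambda>n. h (f n) (g n))"
  using rec_comp[OF assms(1) rec_pair[OF assms(2,3)]] by simp

lemma rec_rec_nat [rec_intros]:
  assumes "total_recursive f" "total_recursive k"
    and "total_recursive (\<lambda>n. g (pfst n) (pfst (psnd n)) (psnd (psnd n)))"
  shows "total_recursive (\<lambda>n. rec_nat (f n) (\<lambda>i r. g n i r) (k n))"
proof -
  \<comment> \<open>All intermediate values are defined, so the option-valued recursion collapses to
    an ordinary one.\<close>
  have *: "rec_nat (Some (f x))
      (\<lambda>i r. Option.bind r (\<lambda>v. Some (g x i v))) j
    = Some (rec_nat (f x) (\<lambda>i r. g x i r) j)" for x j
    by (induction j) auto
  have "total_recursive (\<lambda>n. rec_nat (f (pfst n)) (\<lambda>i r. g (pfst n) i r) (psnd n))"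
    using partial_recursive_in.prim_rec[OF assms(1,3)[unfolded total_recursive_def partial_recursive_def]]
    by (simp add: total_recursive_def partial_recursive_def * case_prod_unfold pfst_def psnd_def)
  from rec_comp2[OF this rec_id assms(2)] show ?thesis .
qed

lemma rec_pred: "total_recursive f \<Longrightarrow> total_recursive (\<lambda>n. f n - 1)"
proof -
  assume f: "total_recursive f"
  \<comment> \<open>A recursion that ignores its accumulated value returns the last index; the
    initial value 0 makes this the truncated predecessor.\<close>
  have "rec_nat 0 (\<lambda>i r. i) m = m - 1" for m :: nat by (cases m) auto
  moreover have "total_recursive (\<lambda>n. rec_nat 0 (\<lambda>i r. i) (f n))"
    by (intro rec_intros f)
  ultimately show ?thesis by simp
qed

lemma rec_minus [rec_intros]:
  assumes "total_recursive f" "total_recursive g"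
  shows "total_recursive (\<lambda>n. f n - g n)"
proof -
  have "rec_nat a (\<lambda>i r. r - 1) m = a - m" for m a :: nat by (induction m) auto
  moreover have "total_recursive (\<lambda>n. rec_nat (f n) (\<lambda>i r. r - 1) (g n))"
    by (intro rec_intros assms rec_pred)
  ultimately show ?thesis by simp
qed

lemma rec_plus [rec_intros]:
  assumes "total_recursive f" "total_recursive g"
  shows "total_recursive (\<lambda>n. f n + g n)"
proof -
  have "rec_nat a (\<lambda>i r. Suc r) m = a + m" for m a :: nat by (induction m) auto
  moreover have "total_recursive (\<lambda>n. rec_nat (f n) (\<lambda>i r. Suc r) (g n))"
    by (intro rec_intros assms)
  ultimately show ?thesis by simp
qed

lemma rec_times [rec_intros]:
  assumes "total_recursive f" "total_recursive g"
  shows "total_recursive (\<lambda>n. f n * g n)"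
proof -
  have "rec_nat 0 (\<lambda>i r. r + a) m = a * m" for m a :: nat by (induction m) auto
  moreover have "total_recursive (\<lambda>n. rec_nat 0 (\<lambda>i r. r + f n) (g n))"
    by (intro rec_intros assms rec_comp[OF assms(1)])
  ultimately show ?thesis by simp
qed

lemma rec_power [rec_intros]:
  assumes "total_recursive f" "total_recursive g"
  shows "total_recursive (\<lambda>n. f n ^ g n)"
proof -
  have "rec_nat 1 (\<lambda>i r. r * a) m = a ^ m" for m a :: nat by (induction m) auto
  moreover have "total_recursive (\<lambda>n. rec_nat 1 (\<lambda>i r. r * f n) (g n))"
    by (intro rec_intros assms rec_comp[OF assms(1)])
  ultimately show ?thesis by simp
qed

section \<open>Closure of decidable predicates; bounded quantifiers and search\<close>

lemma decidable_subst: "decidable P \<Longrightarrow> total_recursive f \<Longrightarrow> decidable (\<lambda>n. P (f n))"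
  unfolding decidable_def by (rule rec_comp)

lemma decidable_eq [rec_intros]:
  assumes "total_recursive f" "total_recursive g"
  shows "decidable (\<lambda>n. f n = g n)"
proof -
  \<comment> \<open>The sum of the two truncated differences is 0 exactly when the arguments
    agree.\<close>
  have "total_recursive (\<lambda>n. 1 - ((f n - g n) + (g n - f n)))"
    by (intro rec_intros assms)
  moreover have "of_bool (a = b) = 1 - ((a - b) + (b - a))" for a b :: nat by auto
  ultimately show ?thesis by (simp only: decidable_def)
qed

lemma decidable_less [rec_intros]:
  assumes "total_recursive f" "total_recursive g"
  shows "decidable (\<lambda>n. f n < g n)"
proof -
  have "total_recursive (\<lambda>n. 1 - (1 - (g n - f n)))"
    by (intro rec_intros assms)
  moreover have "of_bool (a < b) = 1 - (1 - (b - a))" for a b :: nat by auto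
  ultimately show ?thesis by (simp only: decidable_def)
qed

lemma decidable_not [rec_intros]:
  assumes "decidable P"
  shows "decidable (\<lambda>n. \<not> P n)"
proof -
  have "total_recursive (\<lambda>n. 1 - of_bool (P n))"
    using assms by (intro rec_intros) (simp add: decidable_def)
  moreover have "of_bool (\<not> a) = 1 - (of_bool a :: nat)" for a by auto
  ultimately show ?thesis by (simp only: decidable_def)
qed

lemma decidable_conj [rec_intros]:
  assumes "decidable P" "decidable Q"
  shows "decidable (\<lambda>n. P n \<and> Q n)"
proof -
  have "total_recursive (\<lambda>n. of_bool (P n) * of_bool (Q n))"
    using assms by (intro rec_intros) (simp_all add: decidable_def)
  then show ?thesis by (simp only: decidable_def of_bool_conj)
qed

lemma decidable_disj [rec_intros]:
  assumes "decidable P" "decidable Q"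
  shows "decidable (\<lambda>n. P n \<or> Q n)"
proof -
  have "decidable (\<lambda>n. \<not> (\<not> P n \<and> \<not> Q n))" by (intro rec_intros assms)
  then show ?thesis by simp
qed

lemma decidable_all_less [rec_intros]:
  assumes "total_recursive b" "decidable (\<lambda>n. P (pfst n) (psnd n))"
  shows "decidable (\<lambda>n. \<forall>i<b n. P n i)"
proof -
  \<comment> \<open>A bounded universal quantifier is a product of characteristic values.\<close>
  have *: "rec_nat 1 (\<lambda>i r. r * of_bool (P n i)) m = (of_bool (\<forall>i<m. P n i) :: nat)" for n m
    by (induction m) (auto simp: less_Suc_eq)
  have P: "decidable (\<lambda>n. P (pfst n) (pfst (psnd n)))"
    using decidable_subst[OF assms(2), of "\<lambda>n. \<langle>pfst n, pfst (psnd n)\<rangle>"]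
    by (simp add: rec_intros)
  have "total_recursive (\<lambda>n. rec_nat 1 (\<lambda>i r. r * of_bool (P n i)) (b n))"
    by (intro rec_intros assms P[unfolded decidable_def])
  then show ?thesis unfolding decidable_def * .
qed

lemma decidable_ex_less [rec_intros]:
  assumes "total_recursive b" "decidable (\<lambda>n. P (pfst n) (psnd n))"
  shows "decidable (\<lambda>n. \<exists>i<b n. P n i)"
proof -
  have "decidable (\<lambda>n. \<not> (\<forall>i<b n. \<not> P n i))" by (intro rec_intros assms)
  then show ?thesis by simp
qed

lemma rec_if [rec_intros]:
  assumes "decidable P" "total_recursive f" "total_recursive g"
  shows "total_recursive (\<lambda>n. if P n then f n else g n)"
proof -
  have "total_recursive (\<lambda>n. of_bool (P n) * f n + (1 - of_bool (P n)) * g n)"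
    using assms by (intro rec_intros) (simp_all add: decidable_def)
  moreover have "(if c then a else b) = of_bool c * a + (1 - of_bool c) * b" for a b :: nat and c
    by auto
  ultimately show ?thesis by (simp only:)
qed

text \<open>Characteristic functions are total, so the demand that earlier values be defined is
  automatic.\<close>

lemma minimization_of_bool:
  "minimization (\<lambda>i. Some (of_bool (\<not> P i))) = (if \<exists>i. P i then Some (LEAST i. P i) else None)"
  by (simp add: minimization_def)

lemma partial_recursive_minimization:
  assumes "decidable P"
  shows "partial_recursive (\<lambda>n. if \<exists>i. P \<langle>n, i\<rangle> then Some (LEAST i. P \<langle>n, i\<rangle>) else None)"
proof -
  have "partial_recursive (\<lambda>n. Some (of_bool (\<not> P n)))"
    using decidable_not[OF assms] by (simp add: decidable_def total_recursive_def)
  then have "partial_recursive (\<lambda>n. minimization (\<lambda>i. Some (of_bool (\<not> P \<langle>n, i\<rangle>))))"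
    unfolding partial_recursive_def by (rule partial_recursive_in.mu)
  then show ?thesis by (simp only: minimization_of_bool)
qed

lemma rec_Least [rec_intros]:
  assumes "decidable (\<lambda>n. P (pfst n) (psnd n))" "\<And>n. \<exists>i. P n i"
  shows "total_recursive (\<lambda>n. LEAST i. P n i)"
  using partial_recursive_minimization[OF assms(1)] assms(2) by (simp add: total_recursive_def)

section \<open>Coded lists\<close>

definition code_len :: "nat \<Rightarrow> nat" where "code_len t = length (list_decode t)"
definition code_drop :: "nat \<Rightarrow> nat \<Rightarrow> nat" where
  "code_drop t i = list_encode (drop i (list_decode t))"
definition code_nth :: "nat \<Rightarrow> nat \<Rightarrow> nat" where
  "code_nth t i = (if i < code_len t then list_decode t ! i else 0)"

lemma code_len_encode [simp]: "code_len (list_encode xs) = length xs"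
  by (simp add: code_len_def)

lemma code_nth_encode [simp]: "i < length xs \<Longrightarrow> code_nth (list_encode xs) i = xs ! i"
  by (simp add: code_nth_def)

lemma pfst_0 [simp]: "pfst 0 = 0"
  and psnd_0 [simp]: "psnd 0 = 0"
  using pfst_pair[of 0 0] psnd_pair[of 0 0] by (simp_all add: prod_encode_def)

text \<open>A nonempty list is coded as the successor of the pair of its head and coded tail.
  Truncated subtraction keeps the empty list at 0, whose projections are again 0; hence the default
  0 in \<open>code_nth\<close>.\<close>

lemma list_encode_tl: "psnd (list_encode xs - 1) = list_encode (tl xs)"
  by (cases xs) auto

lemma list_encode_hd: "pfst (list_encode xs - 1) = (if xs = [] then 0 else hd xs)"
  by (cases xs) auto

lemma rec_code_drop [rec_intros]:
  assumes "total_recursive f" "total_recursive g"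
  shows "total_recursive (\<lambda>n. code_drop (f n) (g n))"
proof -
  have "rec_nat t (\<lambda>i r. psnd (r - 1)) i = code_drop t i" for t i
    unfolding code_drop_def
  proof (induction i)
    case (Suc i)
    then show ?case by (simp add: list_encode_tl[unfolded One_nat_def] drop_Suc tl_drop)
  qed simp
  moreover have "total_recursive (\<lambda>n. rec_nat (f n) (\<lambda>i r. psnd (r - 1)) (g n))"
    by (intro rec_intros assms)
  ultimately show ?thesis by simp
qed

lemma rec_code_nth [rec_intros]:
  assumes "total_recursive f" "total_recursive g"
  shows "total_recursive (\<lambda>n. code_nth (f n) (g n))"
proof -
  have "code_nth t i = pfst (code_drop t i - 1)" for t i
    by (simp add: code_nth_def code_drop_def list_encode_hd[unfolded One_nat_def] code_len_def hd_drop_conv_nth)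
  moreover have "total_recursive (\<lambda>n. pfst (code_drop (f n) (g n) - 1))"
    by (intro rec_intros assms)
  ultimately show ?thesis by simp
qed

text \<open>The length is the least number of elements whose removal leaves the code 0 of the empty
  list.\<close>

lemma rec_code_len [rec_intros]:
  assumes "total_recursive f"
  shows "total_recursive (\<lambda>n. code_len (f n))"
proof -
  have eq0: "code_drop t i = 0 \<longleftrightarrow> code_len t \<le> i" for t i
    using list_encode_eq[of "drop i (list_decode t)" "[]"] by (simp add: code_drop_def code_len_def)
  have "(LEAST i. code_drop t i = 0) = code_len t" for t
    unfolding eq0 by (rule Least_equality) auto
  moreover have "total_recursive (\<lambda>n. LEAST i. code_drop (f n) i = 0)"
    by (intro rec_intros rec_comp[OF assms]) (auto simp: eq0)
  ultimately show ?thesis by simp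
qed

text \<open>Turns quantification over a coded list into a bounded quantifier, which preserves
  decidability.\<close>

lemma set_list_decode: "(\<forall>m\<in>set (list_decode P). Q m) \<longleftrightarrow> (\<forall>i<code_len P. Q (code_nth P i))"
  by (auto simp: all_set_conv_all_nth code_len_def code_nth_def)

lemma set_list_decode_ex: "(\<exists>m\<in>set (list_decode P). Q m) \<longleftrightarrow> (\<exists>i<code_len P. Q (code_nth P i))"
  using set_list_decode[of P "\<lambda>m. \<not> Q m"] by blast

section \<open>Recursively enumerable predicates\<close>

definition re :: "(nat \<Rightarrow> bool) \<Rightarrow> bool" where
  "re P \<longleftrightarrow> (\<exists>D. decidable D \<and> (\<forall>n. P n \<longleftrightarrow> (\<exists>w. D \<langle>n, w\<rangle>)))"

lemma re_subst:
  assumes "re P" "total_recursive f"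
  shows "re (\<lambda>n. P (f n))"
proof -
  obtain D where D: "decidable D" "\<And>n. P n \<longleftrightarrow> (\<exists>w. D \<langle>n, w\<rangle>)"
    using assms by (auto simp: re_def)
  have "decidable (\<lambda>n. D \<langle>f (pfst n), psnd n\<rangle>)"
    by (intro decidable_subst[OF D(1)] rec_comp[OF assms(2)] rec_intros)
  then show ?thesis unfolding re_def D(2) by (intro exI conjI) auto
qed

lemma re_conj_decidable:
  assumes "re P" "decidable Q"
  shows "re (\<lambda>n. Q n \<and> P n)"
proof -
  obtain D where D: "decidable D" "\<And>n. P n \<longleftrightarrow> (\<exists>w. D \<langle>n, w\<rangle>)"
    using assms by (auto simp: re_def)
  have "decidable (\<lambda>n. Q (pfst n) \<and> D n)"
    by (intro decidable_conj decidable_subst[OF assms(2)] rec_intros D(1))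
  then show ?thesis unfolding re_def D(2) by (intro exI conjI) auto
qed

text \<open>The new existential witness and the old one are merged into one coded pair.\<close>

lemma re_ex:
  assumes "re (\<lambda>n. P (pfst n) (psnd n))"
  shows "re (\<lambda>n. \<exists>i. P n i)"
proof -
  obtain D where D: "decidable D" "\<And>n. P (pfst n) (psnd n) \<longleftrightarrow> (\<exists>w. D \<langle>n, w\<rangle>)"
    using assms by (auto simp: re_def)
  have "decidable (\<lambda>n. D \<langle>\<langle>pfst n, pfst (psnd n)\<rangle>, psnd (psnd n)\<rangle>)"
    by (intro decidable_subst[OF D(1)] rec_intros)
  moreover have "(\<exists>i. P n i) \<longleftrightarrow> (\<exists>w. D \<langle>\<langle>n, pfst w\<rangle>, psnd w\<rangle>)" for n
    using D(2)[of "\<langle>n, i\<rangle>" for i] by (metis pfst_pair psnd_pair)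
  ultimately show ?thesis unfolding re_def by (intro exI conjI) auto
qed

text \<open>Search for a coded pair of a value and a witness, and output its value part.
  \<open>R\<close> may relate one argument to many values; the search commits to one of
  them.\<close>

lemma re_uniformization:
  assumes "re (\<lambda>n. R (pfst n) (psnd n))"
  obtains \<theta> where "partial_recursive \<theta>" "\<And>x v. \<theta> x = Some v \<Longrightarrow> R x v" "\<And>x v. R x v \<Longrightarrow> \<theta> x \<noteq> None"
proof -
  obtain D where D: "decidable D" "\<And>n. R (pfst n) (psnd n) \<longleftrightarrow> (\<exists>w. D \<langle>n, w\<rangle>)"
    using assms by (auto simp: re_def)
  define E where "E n = D \<langle>\<langle>pfst n, pfst (psnd n)\<rangle>, psnd (psnd n)\<rangle>" for n
  have "decidable E"
    unfolding E_def by (intro decidable_subst[OF D(1)] rec_intros)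
  define h where "h n = (if \<exists>i. E \<langle>n, i\<rangle> then Some (LEAST i. E \<langle>n, i\<rangle>) else None)" for n
  have R: "R x v \<longleftrightarrow> (\<exists>w. E \<langle>x, \<langle>v, w\<rangle>\<rangle>)" for x v
    using D(2)[of "\<langle>x, v\<rangle>"] by (simp add: E_def)
  have "partial_recursive (\<lambda>n. Option.bind (h n) (\<lambda>w. Some (pfst w)))"
    unfolding partial_recursive_def
  proof (rule partial_recursive_in.comp)
    show "partial_recursive_in {} h"
      using partial_recursive_minimization[OF \<open>decidable E\<close>]
      by (simp add: h_def[abs_def] partial_recursive_def)
    show "partial_recursive_in {} (\<lambda>w. Some (pfst w))"
      unfolding pfst_def by (rule partial_recursive_in.left)
  qed
  moreover have "R x v" if "Option.bind (h x) (\<lambda>w. Some (pfst w)) = Some v" for x v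
  proof -
    have ex: "\<exists>i. E \<langle>x, i\<rangle>" and v: "v = pfst (LEAST i. E \<langle>x, i\<rangle>)"
      using that by (auto simp: h_def split: if_splits)
    from LeastI_ex[OF ex] show ?thesis
      unfolding R v by (metis pair_pfst_psnd)
  qed
  moreover have "Option.bind (h x) (\<lambda>w. Some (pfst w)) \<noteq> None" if "R x v" for x v
    using that by (auto simp: R h_def)
  ultimately show ?thesis by (rule that)
qed

section \<open>Enumerability of inductively generated sets\<close>

text \<open>\<open>V a P n\<close> means that a rule with side data \<open>a\<close> leads from the
  premises coded by \<open>P\<close> to \<open>n\<close>. Both oracle evaluation and bigness will be
  instances, so enumerability is proved once for all such systems.\<close>

inductive derivable :: "(nat \<Rightarrow> nat \<Rightarrow> nat \<Rightarrow> bool) \<Rightarrow> nat \<Rightarrow> bool" for V where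
  "V a P n \<Longrightarrow> (\<And>m. m \<in> set (list_decode P) \<Longrightarrow> derivable V m) \<Longrightarrow> derivable V n"

text \<open>Derivations are coded as lists of entries \<open>\<langle>n, \<langle>a, P\<rangle>\<rangle>\<close>; an entry is justified by the later ones.\<close>

definition justified :: "(nat \<Rightarrow> nat \<Rightarrow> nat \<Rightarrow> bool) \<Rightarrow> nat \<Rightarrow> nat list \<Rightarrow> bool" where
  "justified V e L \<longleftrightarrow> V (pfst (psnd e)) (psnd (psnd e)) (pfst e) \<and>
     (\<forall>m\<in>set (list_decode (psnd (psnd e))). \<exists>e'\<in>set L. pfst e' = m)"

fun derivation :: "(nat \<Rightarrow> nat \<Rightarrow> nat \<Rightarrow> bool) \<Rightarrow> nat list \<Rightarrow> bool" where
  "derivation V [] \<longleftrightarrow> True"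
| "derivation V (e # L) \<longleftrightarrow> justified V e L \<and> derivation V L"

lemma derivation_append: "derivation V L \<Longrightarrow> derivation V L' \<Longrightarrow> derivation V (L @ L')"
  by (induction L) (auto simp: justified_def)

text \<open>The premises of an entry are conclusions of later entries, hence derivable by induction
  on the list.\<close>

lemma derivation_sound: "derivation V L \<Longrightarrow> e \<in> set L \<Longrightarrow> derivable V (pfst e)"
proof (induction L arbitrary: e)
  case (Cons d L)
  have d: "justified V d L" and L: "derivation V L"
    using Cons.prems(1) by (simp_all only: derivation.simps)
  note IH = Cons.IH[OF L]
  have "derivable V (pfst d)"
  proof (rule derivable.intros)
    show "V (pfst (psnd d)) (psnd (psnd d)) (pfst d)"
      using d unfolding justified_def by (rule conjunct1)
    fix m assume "m \<in> set (list_decode (psnd (psnd d)))"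
    then obtain e' where "e' \<in> set L" "pfst e' = m"
      using d unfolding justified_def by meson
    with IH[of e'] show "derivable V m" by (simp only:)
  qed
  with Cons.prems(2) IH[of e] show ?case by (metis set_ConsD)
qed simp

lemma derivation_complete:
  assumes "derivable V n"
  shows "\<exists>L. derivation V L \<and> n \<in> pfst ` set L"
  using assms
proof induction
  case (1 a P n)
  \<comment> \<open>Each premise has its own derivation; concatenating them one at a time gives a
    single list that covers all premises.\<close>
  have "\<exists>L. derivation V L \<and> set ms \<subseteq> pfst ` set L" if "set ms \<subseteq> set (list_decode P)" for ms
    using that
  proof (induction ms)
    case Nil
    have "derivation V []" by simp
    then show ?case by (metis empty_subsetI list.set(1))
  next
    case (Cons m ms)
    then have "set ms \<subseteq> set (list_decode P)" and m: "m \<in> set (list_decode P)" by simp_all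
    with Cons.IH obtain L where L: "derivation V L" "set ms \<subseteq> pfst ` set L" by blast
    obtain L' where L': "derivation V L'" "m \<in> pfst ` set L'"
      using 1(3)[OF m] by blast
    have "set (m # ms) \<subseteq> pfst ` set (L' @ L)"
      using L(2) L'(2) by (simp add: image_Un le_supI2)
    with derivation_append[OF L'(1) L(1)] show ?case by blast
  qed
  then obtain L where L: "derivation V L" "set (list_decode P) \<subseteq> pfst ` set L" by blast
  from L(2) 1(1) have "justified V \<langle>n, \<langle>a, P\<rangle>\<rangle> L"
    unfolding justified_def pfst_pair psnd_pair by blast
  with L(1) have "derivation V (\<langle>n, \<langle>a, P\<rangle>\<rangle> # L)" by simp
  moreover have "n \<in> pfst ` set (\<langle>n, \<langle>a, P\<rangle>\<rangle> # L)" by simp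
  ultimately show ?case by blast
qed

text \<open>The index form uses only a bounded quantifier, so it can be checked on codes.\<close>

lemma derivation_iff_nth:
  "derivation V L \<longleftrightarrow> (\<forall>i<length L. justified V (L ! i) (drop (Suc i) L))"
proof (induction L)
  case (Cons e L)
  then show ?case by (simp add: All_less_Suc2)
qed simp

text \<open>The existential witness is a coded derivation. The hypothesis asks for decidability
  under recursive substitution, the shape that the closure rules can use and produce.\<close>

lemma re_derivable:
  assumes V: "\<And>f g h. total_recursive f \<Longrightarrow> total_recursive g \<Longrightarrow> total_recursive h \<Longrightarrow>
    decidable (\<lambda>n. V (f n) (g n) (h n))"
  shows "re (derivable V)"
proof -
  have just: "decidable (\<lambda>n. justified V (f n) (list_decode (g n)))"
    if fg: "total_recursive f" "total_recursive g" for f g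
    unfolding justified_def set_list_decode set_list_decode_ex
    by (intro V rec_intros rec_comp[OF fg(1)] rec_comp[OF fg(2)] fg)
  define D where "D n \<longleftrightarrow> (\<forall>i<code_len (psnd n).
      justified V (code_nth (psnd n) i) (list_decode (code_drop (psnd n) (Suc i)))) \<and>
    (\<exists>i<code_len (psnd n). pfst (code_nth (psnd n) i) = pfst n)" for n
  have "decidable D" unfolding D_def[abs_def] by (intro just rec_intros)
  moreover have "derivable V n \<longleftrightarrow> (\<exists>w. D \<langle>n, w\<rangle>)" for n
  proof -
    have D: "D \<langle>n, list_encode L\<rangle> \<longleftrightarrow> derivation V L \<and> n \<in> pfst ` set L" for L
      using set_list_decode_ex[of "list_encode L" "\<lambda>e. pfst e = n"]
      by (auto simp: D_def derivation_iff_nth code_drop_def)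
    show ?thesis
    proof
      assume "derivable V n"
      then show "\<exists>w. D \<langle>n, w\<rangle>" using derivation_complete D by blast
    next
      assume "\<exists>w. D \<langle>n, w\<rangle>"
      then obtain w where "D \<langle>n, list_encode (list_decode w)\<rangle>" by auto
      then show "derivable V n" unfolding D using derivation_sound by blast
    qed
  qed
  ultimately show ?thesis unfolding re_def by blast
qed

section \<open>Oracle computations\<close>

text \<open>The oracle is a relation, so that finite strings can be used as partial oracles.\<close>

inductive ev :: "(nat \<Rightarrow> nat \<Rightarrow> bool) \<Rightarrow> nat \<Rightarrow> nat \<Rightarrow> nat \<Rightarrow> bool" for Q where
  zero: "ev Q \<langle>0, a\<rangle> x 0"
| succ: "ev Q \<langle>Suc 0, a\<rangle> x (Suc x)"
| left: "ev Q \<langle>2, a\<rangle> x (pfst x)"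
| right: "ev Q \<langle>3, a\<rangle> x (psnd x)"
| query: "Q x v \<Longrightarrow> ev Q \<langle>4, a\<rangle> x v"
| pair: "ev Q c x v \<Longrightarrow> ev Q d x w \<Longrightarrow> ev Q \<langle>5, \<langle>c, d\<rangle>\<rangle> x \<langle>v, w\<rangle>"
| comp: "ev Q d x w \<Longrightarrow> ev Q c w v \<Longrightarrow> ev Q \<langle>6, \<langle>c, d\<rangle>\<rangle> x v"
| rec0: "ev Q c x v \<Longrightarrow> ev Q \<langle>7, \<langle>c, d\<rangle>\<rangle> \<langle>x, 0\<rangle> v"
| recS: "ev Q \<langle>7, \<langle>c, d\<rangle>\<rangle> \<langle>x, i\<rangle> w \<Longrightarrow> ev Q d \<langle>x, \<langle>i, w\<rangle>\<rangle> v \<Longrightarrow>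
    ev Q \<langle>7, \<langle>c, d\<rangle>\<rangle> \<langle>x, Suc i\<rangle> v"
| mu: "ev Q c \<langle>x, i\<rangle> 0 \<Longrightarrow> (\<And>j. j < i \<Longrightarrow> \<exists>w. ev Q c \<langle>x, j\<rangle> (Suc w)) \<Longrightarrow>
    ev Q \<langle>8, \<langle>c, d\<rangle>\<rangle> x i"

text \<open>Inversion rules: the tag of a program determines its clause, and tag 7 splits on the
  recursion argument.\<close>

lemma ev_simps:
  "ev Q \<langle>0, a\<rangle> x v \<longleftrightarrow> v = 0"
  "ev Q \<langle>Suc 0, a\<rangle> x v \<longleftrightarrow> v = Suc x"
  "ev Q \<langle>2, a\<rangle> x v \<longleftrightarrow> v = pfst x"
  "ev Q \<langle>3, a\<rangle> x v \<longleftrightarrow> v = psnd x"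
  "ev Q \<langle>4, a\<rangle> x v \<longleftrightarrow> Q x v"
  "ev Q \<langle>5, \<langle>c, d\<rangle>\<rangle> x v \<longleftrightarrow> ev Q c x (pfst v) \<and> ev Q d x (psnd v)"
  "ev Q \<langle>6, \<langle>c, d\<rangle>\<rangle> x v \<longleftrightarrow> (\<exists>w. ev Q d x w \<and> ev Q c w v)"
  "ev Q \<langle>7, \<langle>c, d\<rangle>\<rangle> \<langle>x, 0\<rangle> v \<longleftrightarrow> ev Q c x v"
  "ev Q \<langle>7, \<langle>c, d\<rangle>\<rangle> \<langle>x, Suc i\<rangle> v \<longleftrightarrow> (\<exists>w. ev Q \<langle>7, \<langle>c, d\<rangle>\<rangle> \<langle>x, i\<rangle> w \<and> ev Q d \<langle>x, \<langle>i, w\<rangle>\<rangle> v)"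
  "ev Q \<langle>8, \<langle>c, d\<rangle>\<rangle> x v \<longleftrightarrow> ev Q c \<langle>x, v\<rangle> 0 \<and> (\<forall>j<v. \<exists>w. ev Q c \<langle>x, j\<rangle> (Suc w))"
  by (subst ev.simps; force)+

section \<open>Monotonicity, determinism and use of oracle computations\<close>

text \<open>The oracle occurs only positively in the rules.\<close>

lemma ev_mono:
  assumes "ev Q c x v" "\<And>x v. Q x v \<Longrightarrow> Q' x v"
  shows "ev Q' c x v"
  using assms(1)
proof induction
  case (mu c x i d)
  then show ?case by (intro ev.mu) auto
next
  case (query x v a)
  then show ?case by (intro ev.query assms(2))
qed (auto intro: ev.intros)

lemma ev_det:
  assumes "ev Q c x v" "\<And>x v w. Q x v \<Longrightarrow> Q x w \<Longrightarrow> v = w"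
  shows "ev Q c x v' \<Longrightarrow> v = v'"
  using assms(1)
proof (induction arbitrary: v')
  case (pair c x v d w)
  from pair.prems have "ev Q c x (pfst v')" "ev Q d x (psnd v')" by (simp_all only: ev_simps)
  from pair.IH(1)[OF this(1)] pair.IH(2)[OF this(2)] show ?case by simp
next
  case (comp d x w c v)
  from comp.prems obtain u where "ev Q d x u" "ev Q c u v'" by (auto simp only: ev_simps)
  with comp.IH show ?case by blast
next
  case (recS c d x i w v)
  from recS.prems obtain u where "ev Q \<langle>7, \<langle>c, d\<rangle>\<rangle> \<langle>x, i\<rangle> u" "ev Q d \<langle>x, \<langle>i, u\<rangle>\<rangle> v'"
    by (auto simp only: ev_simps)
  with recS.IH show ?case by blast
next
  case (mu c x i d)
  from mu.prems have *: "ev Q c \<langle>x, v'\<rangle> 0" "\<And>j. j < v' \<Longrightarrow> \<exists>w. ev Q c \<langle>x, j\<rangle> (Suc w)"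
    by (simp_all only: ev_simps)
  \<comment> \<open>At the smaller of two results of an unbounded search the searched program would
    return both 0 and a successor.\<close>
  have "\<not> v' < i" using mu.IH(2) *(1) by (metis nat.distinct(1))
  moreover have "\<not> i < v'" using mu.IH(1) *(2) by (metis nat.distinct(1))
  ultimately show ?case by simp
next
  case (query x v a)
  with assms(2) show ?case by (simp only: ev_simps)
qed (simp_all only: ev_simps)

definition prefix_oracle :: "(nat \<Rightarrow> nat) \<Rightarrow> nat \<Rightarrow> nat \<Rightarrow> nat \<Rightarrow> bool" where
  "prefix_oracle Y n i v \<longleftrightarrow> i < n \<and> v = Y i"

lemma ev_prefix_mono: "ev (prefix_oracle Y n) c x v \<Longrightarrow> n \<le> n' \<Longrightarrow> ev (prefix_oracle Y n') c x v"
  by (erule ev_mono) (simp add: prefix_oracle_def)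

text \<open>The use principle: a halting computation asks finitely many queries, so a long enough
  prefix of \<open>Y\<close> answers them all.\<close>

lemma ev_use:
  assumes "ev (\<lambda>n v. v = Y n) c x v"
  shows "\<exists>n. ev (prefix_oracle Y n) c x v"
  using assms
proof induction
  case (query x v a)
  then have "ev (prefix_oracle Y (Suc x)) \<langle>4, a\<rangle> x v"
    by (intro ev.query) (simp add: prefix_oracle_def)
  then show ?case ..
next
  case (pair c x v d w)
  then obtain N M where "ev (prefix_oracle Y N) c x v" "ev (prefix_oracle Y M) d x w" by meson
  then have "ev (prefix_oracle Y (max N M)) \<langle>5, \<langle>c, d\<rangle>\<rangle> x \<langle>v, w\<rangle>"
    by (intro ev.pair) (erule ev_prefix_mono, simp)+
  then show ?case ..
next
  case (comp d x w c v)
  then obtain N M where "ev (prefix_oracle Y N) d x w" "ev (prefix_oracle Y M) c w v" by meson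
  then have "ev (prefix_oracle Y (max N M)) \<langle>6, \<langle>c, d\<rangle>\<rangle> x v"
    by (intro ev.comp) (erule ev_prefix_mono, simp)+
  then show ?case ..
next
  case (rec0 c x v d)
  then show ?case by (meson ev.rec0)
next
  case (recS c d x i w v)
  then obtain N M where "ev (prefix_oracle Y N) \<langle>7, \<langle>c, d\<rangle>\<rangle> \<langle>x, i\<rangle> w"
    "ev (prefix_oracle Y M) d \<langle>x, \<langle>i, w\<rangle>\<rangle> v" by meson
  then have "ev (prefix_oracle Y (max N M)) \<langle>7, \<langle>c, d\<rangle>\<rangle> \<langle>x, Suc i\<rangle> v"
    by (intro ev.recS) (erule ev_prefix_mono, simp)+
  then show ?case ..
next
  case (mu c x i d)
  then obtain N where N: "ev (prefix_oracle Y N) c \<langle>x, i\<rangle> 0" by meson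
  have "\<forall>j\<in>{..<i}. \<exists>M. \<exists>w. ev (prefix_oracle Y M) c \<langle>x, j\<rangle> (Suc w)"
    using mu.IH(2) by (meson lessThan_iff)
  from bchoice[OF this] obtain M where
    M: "\<And>j. j < i \<Longrightarrow> \<exists>w. ev (prefix_oracle Y (M j)) c \<langle>x, j\<rangle> (Suc w)" by (meson lessThan_iff)
  \<comment> \<open>A common bound on the prefixes used at \<open>i\<close> and at all earlier
    arguments of the search.\<close>
  define n where "n = max N (Max (M ` {..i}))"
  have le: "M j \<le> n" if "j < i" for j
    unfolding n_def by (rule max.coboundedI2) (use that in simp)
  have "ev (prefix_oracle Y n) \<langle>8, \<langle>c, d\<rangle>\<rangle> x i"
  proof (rule ev.mu)
    show "ev (prefix_oracle Y n) c \<langle>x, i\<rangle> 0"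
      by (rule ev_prefix_mono[OF N]) (simp add: n_def)
    show "\<exists>w. ev (prefix_oracle Y n) c \<langle>x, j\<rangle> (Suc w)" if "j < i" for j
      using M[OF that] ev_prefix_mono[OF _ le[OF that]] by meson
  qed
  then show ?case ..
qed (rule exI, rule ev.intros)+

section \<open>Programs for all partial recursive functions\<close>

lemma ev_rec:
  "ev Q \<langle>7, \<langle>c, d\<rangle>\<rangle> \<langle>x, k\<rangle> v \<longleftrightarrow> rec_nat (f x)
      (\<lambda>i r. Option.bind r (\<lambda>v. g \<langle>x, \<langle>i, v\<rangle>\<rangle>)) k = Some v"
  if "\<And>x v. ev Q c x v \<longleftrightarrow> f x = Some v" "\<And>x v. ev Q d x v \<longleftrightarrow> g x = Some v"
proof (induction k arbitrary: v)
  case (Suc k)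
  show ?case
    by (simp only: ev_simps Suc.IH that(2) rec_nat_Suc_imp[OF refl] bind_eq_Some_conv)
qed (simp add: ev_simps that)

lemma minimization_eq_Some:
  "minimization h = Some i \<longleftrightarrow> h i = Some 0 \<and> (\<forall>j<i. \<exists>w. h j = Some (Suc w))"
proof
  assume *: "h i = Some 0 \<and> (\<forall>j<i. \<exists>w. h j = Some (Suc w))"
  then have "(LEAST i. h i = Some 0) = i"
    by (intro Least_equality) (auto simp: not_less[symmetric])
  moreover have "\<exists>i. h i = Some 0 \<and> (\<forall>j<i. h j \<noteq> None)"
    using * by (intro exI[of _ i]) auto
  ultimately show "minimization h = Some i" by (simp add: minimization_def)
next
  assume *: "minimization h = Some i"
  then have ex: "\<exists>i. h i = Some 0 \<and> (\<forall>j<i. h j \<noteq> None)" and i: "i = (LEAST i. h i = Some 0)"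
    by (auto simp: minimization_def split: if_splits)
  from ex obtain k where k: "h k = Some 0" "\<forall>j<k. h j \<noteq> None" by blast
  \<comment> \<open>Definedness is only given below some zero \<open>k\<close>; as the least zero is
    at most \<open>k\<close>, it also holds below the least zero.\<close>
  have "i \<le> k" unfolding i using k(1) by (rule Least_le)
  have "h i = Some 0" unfolding i using k(1) by (rule LeastI)
  moreover have "\<exists>w. h j = Some (Suc w)" if "j < i" for j
  proof -
    have "h j \<noteq> Some 0" using that unfolding i by (rule not_less_Least)
    moreover have "h j \<noteq> None" using k(2) that \<open>i \<le> k\<close> by simp
    then obtain w where "h j = Some w" by blast
    ultimately show ?thesis by (metis not0_implies_Suc)
  qed
  ultimately show "h i = Some 0 \<and> (\<forall>j<i. \<exists>w. h j = Some (Suc w))" by blast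
qed

text \<open>Every scheme has its tag. The assumption on \<open>Q\<close> covers both
  \<open>A = {Y}\<close> with the graph of \<open>Y\<close> as oracle and \<open>A = {}\<close> with
  an arbitrary oracle.\<close>

lemma ev_complete:
  assumes "partial_recursive_in A f" "\<And>X n v. X \<in> A \<Longrightarrow> Q n v \<longleftrightarrow> v = X n"
  shows "\<exists>c. \<forall>x v. ev Q c x v \<longleftrightarrow> f x = Some v"
  using assms(1)
proof induction
  case zero
  show ?case by (rule exI[of _ "\<langle>0, 0\<rangle>"]) (auto simp: ev_simps)
next
  case succ
  show ?case by (rule exI[of _ "\<langle>1, 0\<rangle>"]) (auto simp: ev_simps)
next
  case left
  show ?case by (rule exI[of _ "\<langle>2, 0\<rangle>"]) (auto simp: ev_simps pfst_def)
next
  case right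
  show ?case by (rule exI[of _ "\<langle>3, 0\<rangle>"]) (auto simp: ev_simps psnd_def)
next
  case (query X)
  show ?case by (rule exI[of _ "\<langle>4, 0\<rangle>"]) (auto simp: ev_simps assms(2)[OF query])
next
  case (pair f g)
  then obtain c d where "\<And>x v. ev Q c x v \<longleftrightarrow> f x = Some v" "\<And>x v. ev Q d x v \<longleftrightarrow> g x = Some v"
    by blast
  then show ?case
    by (intro exI[of _ "\<langle>5, \<langle>c, d\<rangle>\<rangle>"]) (auto simp: ev_simps bind_eq_Some_conv)
next
  case (comp f g)
  then obtain c d where "\<And>x v. ev Q c x v \<longleftrightarrow> f x = Some v" "\<And>x v. ev Q d x v \<longleftrightarrow> g x = Some v"
    by blast
  then show ?case
    by (intro exI[of _ "\<langle>6, \<langle>c, d\<rangle>\<rangle>"]) (auto simp: ev_simps bind_eq_Some_conv)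
next
  case (prim_rec f g)
  then obtain c d where cd: "\<And>x v. ev Q c x v \<longleftrightarrow> f x = Some v" "\<And>x v. ev Q d x v \<longleftrightarrow> g x = Some v"
    by blast
  have "ev Q \<langle>7, \<langle>c, d\<rangle>\<rangle> n v \<longleftrightarrow> (case prod_decode n of (x, k) \<Rightarrow>
         rec_nat (f x) (\<lambda>i r. Option.bind r (\<lambda>v. g \<langle>x, \<langle>i, v\<rangle>\<rangle>)) k) = Some v" for n v
    by (rule pair_cases[of n]) (simp add: ev_rec[OF cd])
  then show ?case by blast
next
  case (mu f)
  then obtain c where "\<And>x v. ev Q c x v \<longleftrightarrow> f x = Some v" by blast
  then show ?case
    by (intro exI[of _ "\<langle>8, \<langle>c, 0\<rangle>\<rangle>"]) (simp add: ev_simps minimization_eq_Some)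
qed

text \<open>Strings are lists written backwards, so that extending a string is consing.\<close>

definition str_oracle :: "nat list \<Rightarrow> nat \<Rightarrow> nat \<Rightarrow> bool" where
  "str_oracle \<sigma> n v \<longleftrightarrow> n < length \<sigma> \<and> v = rev \<sigma> ! n"

section \<open>Enumerability of computations from finite strings\<close>

text \<open>One disjunct per clause of \<open>ev\<close>, for the coded string \<open>t\<close>, tag
  \<open>g\<close> and remaining program \<open>e\<close>; \<open>a\<close> carries the intermediate
  value and \<open>m\<close> the predecessor of the recursion argument. For tag 8 the successor
  values at \<open>j < v\<close> are read back from the premises in \<open>P\<close>, which avoids
  an unbounded quantifier.\<close>

definition ev_rule :: "nat \<Rightarrow> nat \<Rightarrow> nat \<Rightarrow> nat \<Rightarrow> nat \<Rightarrow> nat \<Rightarrow> nat \<Rightarrow> nat \<Rightarrow> bool" where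
  "ev_rule a P t g e x v m \<longleftrightarrow>
     (g = 0 \<and> v = 0) \<or> (g = 1 \<and> v = Suc x) \<or> (g = 2 \<and> v = pfst x) \<or> (g = 3 \<and> v = psnd x) \<or>
     (g = 4 \<and> x < code_len t \<and> v = code_nth t (code_len t - Suc x)) \<or>
     (g = 5 \<and> P = list_encode [\<langle>t, \<langle>pfst e, \<langle>x, pfst v\<rangle>\<rangle>\<rangle>, \<langle>t, \<langle>psnd e, \<langle>x, psnd v\<rangle>\<rangle>\<rangle>]) \<or>
     (g = 6 \<and> P = list_encode [\<langle>t, \<langle>psnd e, \<langle>x, a\<rangle>\<rangle>\<rangle>, \<langle>t, \<langle>pfst e, \<langle>a, v\<rangle>\<rangle>\<rangle>]) \<or>
     (g = 7 \<and> psnd x = 0 \<and> P = list_encode [\<langle>t, \<langle>pfst e, \<langle>pfst x, v\<rangle>\<rangle>\<rangle>]) \<or>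
     (g = 7 \<and> psnd x = Suc m \<and> P = list_encode [\<langle>t, \<langle>\<langle>7, e\<rangle>, \<langle>\<langle>pfst x, m\<rangle>, a\<rangle>\<rangle>\<rangle>,
        \<langle>t, \<langle>psnd e, \<langle>\<langle>pfst x, \<langle>m, a\<rangle>\<rangle>, v\<rangle>\<rangle>\<rangle>]) \<or>
     (g = 8 \<and> code_len P = Suc v \<and> code_nth P v = \<langle>t, \<langle>pfst e, \<langle>\<langle>x, v\<rangle>, 0\<rangle>\<rangle>\<rangle> \<and>
        (\<forall>j<v. code_nth P j =
           \<langle>t, \<langle>pfst e, \<langle>\<langle>x, j\<rangle>, Suc (psnd (psnd (psnd (code_nth P j))) - 1)\<rangle>\<rangle>\<rangle>))"

definition ev_sys :: "nat \<Rightarrow> nat \<Rightarrow> nat \<Rightarrow> bool" where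
  "ev_sys a P n \<longleftrightarrow> ev_rule a P (pfst n) (pfst (pfst (psnd n))) (psnd (pfst (psnd n)))
     (pfst (psnd (psnd n))) (psnd (psnd (psnd n))) (psnd (pfst (psnd (psnd n))) - 1)"

lemma ev_sys_eq:
  "ev_sys a P \<langle>t, \<langle>\<langle>g, e\<rangle>, \<langle>x, v\<rangle>\<rangle>\<rangle> \<longleftrightarrow> ev_rule a P t g e x v (psnd x - 1)"
  by (simp add: ev_sys_def)

lemma decidable_ev_sys:
  assumes "total_recursive f" "total_recursive g" "total_recursive h"
  shows "decidable (\<lambda>n. ev_sys (f n) (g n) (h n))"
  unfolding ev_sys_def ev_rule_def list_encode.simps
  by (intro rec_intros assms assms[THEN rec_comp])

lemma str_oracle_decode:
  "str_oracle (list_decode t) x v \<longleftrightarrow> x < code_len t \<and> v = code_nth t (code_len t - Suc x)"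
  by (auto simp: str_oracle_def code_len_def code_nth_def rev_nth)

lemma derivable_imp_ev:
  "derivable ev_sys n \<Longrightarrow> n = \<langle>t, \<langle>c, \<langle>x, v\<rangle>\<rangle>\<rangle> \<Longrightarrow> ev (str_oracle (list_decode t)) c x v"
proof (induction arbitrary: t c x v rule: derivable.induct)
  case (1 a P n)
  obtain g e where c: "c = \<langle>g, e\<rangle>" by (rule pair_cases)
  obtain d d' where e: "e = \<langle>d, d'\<rangle>" by (rule pair_cases)
  have rule: "ev_rule a P t g \<langle>d, d'\<rangle> x v (psnd x - 1)"
    using 1(1) unfolding 1(4) c e ev_sys_eq .
  have IH: "ev (str_oracle (list_decode t)) c' x' v'"
    if "\<langle>t, \<langle>c', \<langle>x', v'\<rangle>\<rangle>\<rangle> \<in> set (list_decode P)" for c' x' v'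
    using 1(3)[OF that refl] .
  show ?case
    using rule unfolding ev_rule_def pfst_pair psnd_pair
  proof (elim disjE conjE)
    assume "g = 5" "P = list_encode [\<langle>t, \<langle>d, \<langle>x, pfst v\<rangle>\<rangle>\<rangle>, \<langle>t, \<langle>d', \<langle>x, psnd v\<rangle>\<rangle>\<rangle>]"
    then show ?thesis by (simp add: c e ev_simps IH del: list_encode.simps)
  next
    assume "g = 6" "P = list_encode [\<langle>t, \<langle>d', \<langle>x, a\<rangle>\<rangle>\<rangle>, \<langle>t, \<langle>d, \<langle>a, v\<rangle>\<rangle>\<rangle>]"
    then have "ev (str_oracle (list_decode t)) d' x a" "ev (str_oracle (list_decode t)) d a v" "g = 6"
      by (simp_all add: IH del: list_encode.simps)
    then show ?thesis by (auto simp: c e ev_simps)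
  next
    assume "g = 7" "psnd x = 0" "P = list_encode [\<langle>t, \<langle>d, \<langle>pfst x, v\<rangle>\<rangle>\<rangle>]"
    then have "ev (str_oracle (list_decode t)) d (pfst x) v" "g = 7" "x = \<langle>pfst x, 0\<rangle>"
      by (simp_all add: IH del: list_encode.simps) (metis pair_pfst_psnd)
    then show ?thesis by (metis c e ev.rec0)
  next
    \<comment> \<open>With \<open>m\<close> instantiated to a truncated predecessor, this equation
      says that the recursion argument is positive.\<close>
    assume *: "g = 7" "psnd x = Suc (psnd x - 1)"
      "P = list_encode [\<langle>t, \<langle>\<langle>7, \<langle>d, d'\<rangle>\<rangle>, \<langle>\<langle>pfst x, psnd x - 1\<rangle>, a\<rangle>\<rangle>\<rangle>,
        \<langle>t, \<langle>d', \<langle>\<langle>pfst x, \<langle>psnd x - 1, a\<rangle>\<rangle>, v\<rangle>\<rangle>\<rangle>]"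
    have "ev (str_oracle (list_decode t)) \<langle>7, \<langle>d, d'\<rangle>\<rangle> \<langle>pfst x, psnd x - 1\<rangle> a"
      "ev (str_oracle (list_decode t)) d' \<langle>pfst x, \<langle>psnd x - 1, a\<rangle>\<rangle> v"
      by (rule IH, simp only: *(3) list_encode_inverse list.set insert_iff simp_thms)+
    then have "ev (str_oracle (list_decode t)) \<langle>7, \<langle>d, d'\<rangle>\<rangle> \<langle>pfst x, Suc (psnd x - 1)\<rangle> v"
      by (rule ev.recS)
    then show ?thesis unfolding *(2)[symmetric] by (simp add: c e *(1))
  next
    assume *: "g = 8" "code_len P = Suc v" "code_nth P v = \<langle>t, \<langle>d, \<langle>\<langle>x, v\<rangle>, 0\<rangle>\<rangle>\<rangle>"
      "\<forall>j<v. code_nth P j = \<langle>t, \<langle>d, \<langle>\<langle>x, j\<rangle>, Suc (psnd (psnd (psnd (code_nth P j))) - 1)\<rangle>\<rangle>\<rangle>"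
    have mem: "code_nth P j \<in> set (list_decode P)" if "j \<le> v" for j
      using that *(2) by (simp add: code_nth_def code_len_def)
    show ?thesis unfolding c e *(1)
    proof (rule ev.mu)
      show "ev (str_oracle (list_decode t)) d \<langle>x, v\<rangle> 0"
        using mem[of v] by (intro IH) (simp only: *(3))
      fix j assume "j < v"
      with mem[of j] *(4) have "\<langle>t, \<langle>d, \<langle>\<langle>x, j\<rangle>, Suc (psnd (psnd (psnd (code_nth P j))) - 1)\<rangle>\<rangle>\<rangle> \<in> set (list_decode P)"
        by (metis less_imp_le_nat)
      from IH[OF this] show "\<exists>w. ev (str_oracle (list_decode t)) d \<langle>x, j\<rangle> (Suc w)" by blast
    qed
  qed (simp_all add: c ev_simps str_oracle_decode)
qed

lemma derivable_list:
  assumes "V a (list_encode ms) n" "\<forall>m\<in>set ms. derivable V m"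
  shows "derivable V n"
  using derivable.intros[of V a "list_encode ms" n] assms by simp

lemma ev_imp_derivable:
  "ev (str_oracle (list_decode t)) c x v \<Longrightarrow> derivable ev_sys \<langle>t, \<langle>c, \<langle>x, v\<rangle>\<rangle>\<rangle>"
proof (induction rule: ev.induct)
  case (zero a x)
  show ?case by (rule derivable_list[of _ 0 "[]"]) (simp_all add: ev_sys_eq ev_rule_def)
next
  case (succ a x)
  show ?case by (rule derivable_list[of _ 0 "[]"]) (simp_all add: ev_sys_eq ev_rule_def)
next
  case (left a x)
  show ?case by (rule derivable_list[of _ 0 "[]"]) (simp_all add: ev_sys_eq ev_rule_def)
next
  case (right a x)
  show ?case by (rule derivable_list[of _ 0 "[]"]) (simp_all add: ev_sys_eq ev_rule_def)
next
  case (query x v a)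
  then show ?case
    by (intro derivable_list[of _ 0 "[]"]) (simp_all add: ev_sys_eq ev_rule_def str_oracle_decode)
next
  case (pair c x v d w)
  then show ?case
    by (intro derivable_list[of _ 0 "[\<langle>t, \<langle>c, \<langle>x, v\<rangle>\<rangle>\<rangle>, \<langle>t, \<langle>d, \<langle>x, w\<rangle>\<rangle>\<rangle>]"])
      (simp_all add: ev_sys_eq ev_rule_def)
next
  case (comp d x w c v)
  then show ?case
    by (intro derivable_list[of _ w "[\<langle>t, \<langle>d, \<langle>x, w\<rangle>\<rangle>\<rangle>, \<langle>t, \<langle>c, \<langle>w, v\<rangle>\<rangle>\<rangle>]"])
      (simp_all add: ev_sys_eq ev_rule_def)
next
  case (rec0 c x v d)
  then show ?case
    by (intro derivable_list[of _ 0 "[\<langle>t, \<langle>c, \<langle>x, v\<rangle>\<rangle>\<rangle>]"]) (simp_all add: ev_sys_eq ev_rule_def)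
next
  case (recS c d x i w v)
  then show ?case
    by (intro derivable_list[of _ w "[\<langle>t, \<langle>\<langle>7, \<langle>c, d\<rangle>\<rangle>, \<langle>\<langle>x, i\<rangle>, w\<rangle>\<rangle>\<rangle>, \<langle>t, \<langle>d, \<langle>\<langle>x, \<langle>i, w\<rangle>\<rangle>, v\<rangle>\<rangle>\<rangle>]"])
      (simp_all add: ev_sys_eq ev_rule_def)
next
  case (mu c x i d)
  then obtain w where w: "\<And>j. j < i \<Longrightarrow> derivable ev_sys \<langle>t, \<langle>c, \<langle>\<langle>x, j\<rangle>, Suc (w j)\<rangle>\<rangle>\<rangle>"
    by metis
  \<comment> \<open>Premises in the order that \<open>ev_rule\<close> expects: the nonzero values at
    arguments below \<open>i\<close>, then the zero at \<open>i\<close>.\<close>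
  let ?L = "map (\<lambda>j. \<langle>t, \<langle>c, \<langle>\<langle>x, j\<rangle>, Suc (w j)\<rangle>\<rangle>\<rangle>) [0..<i] @ [\<langle>t, \<langle>c, \<langle>\<langle>x, i\<rangle>, 0\<rangle>\<rangle>\<rangle>]"
  show ?case
  proof (rule derivable_list[of _ 0 ?L])
    show "ev_sys 0 (list_encode ?L) \<langle>t, \<langle>\<langle>8, \<langle>c, d\<rangle>\<rangle>, \<langle>x, i\<rangle>\<rangle>\<rangle>"
      unfolding ev_sys_eq ev_rule_def by (simp add: nth_append)
    show "\<forall>m\<in>set ?L. derivable ev_sys m" using w mu(2) by simp
  qed
qed

lemma re_ev:
  assumes "total_recursive t" "total_recursive c" "total_recursive x" "total_recursive v"
  shows "re (\<lambda>n. ev (str_oracle (list_decode (t n))) (c n) (x n) (v n))"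
proof -
  have "ev (str_oracle (list_decode t)) c x v \<longleftrightarrow> derivable ev_sys \<langle>t, \<langle>c, \<langle>x, v\<rangle>\<rangle>\<rangle>" for t c x v
    using ev_imp_derivable derivable_imp_ev by blast
  moreover have "re (\<lambda>n. derivable ev_sys \<langle>t n, \<langle>c n, \<langle>x n, v n\<rangle>\<rangle>\<rangle>)"
    by (intro re_subst[OF re_derivable] decidable_ev_sys rec_intros assms)
  ultimately show ?thesis by simp
qed

section \<open>Linearly universal functions that are undefined on an initial segment\<close>

lemma pow2_times_odd_inj:
  fixes c c' x x' :: nat
  assumes "2 ^ c * Suc (2 * x) = 2 ^ c' * Suc (2 * x')"
  shows "c = c' \<and> x = x'"
  using assms
proof (induction c arbitrary: c')
  case 0
  then have "odd (2 ^ c' * Suc (2 * x'))" by (metis even_Suc dvd_triv_left power_0 mult_1)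
  then have "c' = 0" by simp
  with 0 show ?case by simp
next
  case (Suc c)
  then have "even (2 ^ c' * Suc (2 * x'))" by (metis dvd_mult2 dvd_triv_left power_Suc)
  then obtain d where "c' = Suc d" by (cases c') auto
  then have "2 ^ c * Suc (2 * x) = 2 ^ d * Suc (2 * x')"
    using Suc.prems by (simp only: power_Suc mult.assoc)
  from Suc.IH[OF this] \<open>c' = Suc d\<close> show ?case by simp
qed

text \<open>Program \<open>c\<close> is placed on the arithmetic progression of the numbers
  \<open>N + 2 ^ c * Suc (2 * x)\<close>. These progressions are disjoint and lie above
  \<open>N\<close>, so each program is embedded linearly while the positions below \<open>N\<close>
  stay free.\<close>

lemma linearly_universal_exists:
  obtains \<psi> where "linearly_universal \<psi>" "\<And>n. n < N \<Longrightarrow> \<psi> n = None"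
proof -
  let ?ev = "ev (str_oracle [])"
  define R where "R n v \<longleftrightarrow> (\<exists>c. \<exists>x. n = N + 2 ^ c * Suc (2 * x) \<and> ?ev c x v)" for n v
  have "re (\<lambda>n. R (pfst n) (psnd n))"
    unfolding R_def
    by (intro re_ex re_conj_decidable re_ev[of "\<lambda>_. 0", simplified] rec_intros)
  then obtain \<psi> where \<psi>: "partial_recursive \<psi>" "\<And>n v. \<psi> n = Some v \<Longrightarrow> R n v"
    "\<And>n v. R n v \<Longrightarrow> \<psi> n \<noteq> None"
    by (rule re_uniformization) blast
  have R: "R (N + 2 ^ c * Suc (2 * x)) v \<longleftrightarrow> ?ev c x v" for c x v
    unfolding R_def by (metis add_left_cancel pow2_times_odd_inj)
  have det: "v = w" if "?ev c x v" "?ev c x w" for c x v w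
    using that(1) _ that(2) by (rule ev_det) (simp add: str_oracle_def)
  have "\<psi> n = None" if "n < N" for n
    using \<psi>(2)[of n] that by (cases "\<psi> n") (auto simp: R_def)
  moreover have "\<exists>a b. \<forall>x. \<psi> (a * x + b) = \<theta> x" if "partial_recursive \<theta>" for \<theta>
  proof -
    have "\<exists>c. \<forall>x v. ?ev c x v \<longleftrightarrow> \<theta> x = Some v"
      using that unfolding partial_recursive_def by (rule ev_complete) simp
    then obtain c where c: "\<And>x v. ?ev c x v \<longleftrightarrow> \<theta> x = Some v" by blast
    have "\<psi> (2 ^ c * 2 * x + (N + 2 ^ c)) = \<theta> x" for x
    proof -
      have eq: "2 ^ c * 2 * x + (N + 2 ^ c) = N + 2 ^ c * Suc (2 * x)" by (simp add: algebra_simps)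
      have "R (N + 2 ^ c * Suc (2 * x)) v \<longleftrightarrow> \<theta> x = Some v" for v by (simp only: R c)
      then show ?thesis unfolding eq using \<psi>(2,3)
        by (metis not_None_eq option.exhaust)
    qed
    then show ?thesis by blast
  qed
  ultimately show ?thesis using \<psi>(1) that unfolding linearly_universal_def by blast
qed

section \<open>Bushy trees\<close>

text \<open>Says that a finite tree above the given string has all its leaves in \<open>A\<close>,
  each of its inner nodes having at least \<open>k\<close> immediate successors within the bound
  \<open>l\<close>. Its negation is smallness.\<close>

inductive big :: "(nat \<Rightarrow> nat) \<Rightarrow> nat \<Rightarrow> (nat list \<Rightarrow> bool) \<Rightarrow> nat list \<Rightarrow> bool" for l k A where
  leaf: "A \<sigma> \<Longrightarrow> big l k A \<sigma>"
| node: "J \<subseteq> {..<l (length \<sigma>)} \<Longrightarrow> k \<le> card J \<Longrightarrow> (\<And>j. j \<in> J \<Longrightarrow> big l k A (j # \<sigma>)) \<Longrightarrow>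
    big l k A \<sigma>"

fun bounded_string :: "(nat \<Rightarrow> nat) \<Rightarrow> nat list \<Rightarrow> bool" where
  "bounded_string l [] \<longleftrightarrow> True"
| "bounded_string l (j # \<sigma>) \<longleftrightarrow> j < l (length \<sigma>) \<and> bounded_string l \<sigma>"

text \<open>Graft the trees for \<open>B\<close> onto the leaves of the tree for
  \<open>A\<close>.\<close>

lemma big_trans:
  assumes "big l k A \<sigma>" "\<And>\<tau>. A \<tau> \<Longrightarrow> big l k B \<tau>"
  shows "big l k B \<sigma>"
  using assms(1) by induction (use assms(2) big.node in blast)+

text \<open>Every node only adds entries below \<open>l\<close>, so the leaves of a witnessing tree
  are bounded extensions of its root.\<close>

lemma big_extensions:
  assumes "big l k A \<sigma>" "bounded_string l \<sigma>"
  shows "big l k (\<lambda>\<tau>. A \<tau> \<and> bounded_string l \<tau> \<and> suffix \<sigma> \<tau>) \<sigma>"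
  using assms
proof induction
  case (leaf \<sigma>)
  then show ?case by (auto intro: big.leaf)
next
  case (node J \<sigma>)
  show ?case
  proof (rule big.node)
    show "J \<subseteq> {..<l (length \<sigma>)}" "k \<le> card J" by (fact node)+
    fix j assume j: "j \<in> J"
    with node have "bounded_string l (j # \<sigma>)" by auto
    from node(4)[OF j this]
    show "big l k (\<lambda>\<tau>. A \<tau> \<and> bounded_string l \<tau> \<and> suffix \<sigma> \<tau>) (j # \<sigma>)"
      by (rule big_trans) (rule big.leaf, meson suffix_ConsD)
  qed
qed

text \<open>In contrapositive form: the union of a \<open>k1\<close>-small and a
  \<open>k2\<close>-small set is \<open>(k1 + k2)\<close>-small. Among \<open>k1 + k2\<close>
  successors of a node, either \<open>k1\<close> are big for \<open>A\<close> or \<open>k2\<close>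
  are big for \<open>B\<close>.\<close>

lemma big_disj:
  assumes "big l (k1 + k2) (\<lambda>\<tau>. A \<tau> \<or> B \<tau>) \<sigma>"
  shows "big l k1 A \<sigma> \<or> big l k2 B \<sigma>"
  using assms
proof induction
  case (leaf \<sigma>)
  then show ?case by (elim disjE) (simp_all add: big.leaf)
next
  case (node J \<sigma>)
  define J1 where "J1 = {j \<in> J. big l k1 A (j # \<sigma>)}"
  have fin: "finite J" using node(1) finite_subset by blast
  have "card J \<le> card J1 + card (J - J1)"
    using card_Un_le[of J1 "J - J1"] by (simp add: J1_def Un_absorb1)
  then consider "k1 \<le> card J1" | "k2 \<le> card (J - J1)" using node(2) by linarith
  then show ?case
  proof cases
    case 1
    have "big l k1 A \<sigma>"
    proof (rule big.node[OF _ 1])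
      show "J1 \<subseteq> {..<l (length \<sigma>)}" using node(1) by (auto simp: J1_def)
      show "big l k1 A (j # \<sigma>)" if "j \<in> J1" for j using that unfolding J1_def by simp
    qed
    then show ?thesis ..
  next
    case 2
    have "big l k2 B \<sigma>"
    proof (rule big.node[OF _ 2])
      show "J - J1 \<subseteq> {..<l (length \<sigma>)}" using node(1) by auto
      show "big l k2 B (j # \<sigma>)" if "j \<in> J - J1" for j
      proof -
        from that have "j \<in> J" "\<not> big l k1 A (j # \<sigma>)" unfolding J1_def by simp_all
        with node(4)[of j] show ?thesis by meson
      qed
    qed
    then show ?thesis ..
  qed
qed

lemma big_pigeonhole:
  assumes "big l (k * Suc u) (\<lambda>\<tau>. \<exists>v<Suc u. A v \<tau>) \<sigma>"
  shows "\<exists>v<Suc u. big l k (A v) \<sigma>"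
  using assms
proof (induction u)
  case (Suc u)
  have "big l (k * Suc u + k) (\<lambda>\<tau>. (\<exists>v<Suc u. A v \<tau>) \<or> A (Suc u) \<tau>) \<sigma>"
  proof -
    have "(\<lambda>\<tau>. \<exists>v<Suc (Suc u). A v \<tau>) = (\<lambda>\<tau>. (\<exists>v<Suc u. A v \<tau>) \<or> A (Suc u) \<tau>)"
      by (intro ext) (auto simp: less_Suc_eq)
    moreover have "k * Suc (Suc u) = k * Suc u + k" by simp
    ultimately show ?thesis using Suc.prems by (simp only:)
  qed
  then have "big l (k * Suc u) (\<lambda>\<tau>. \<exists>v<Suc u. A v \<tau>) \<sigma> \<or> big l k (A (Suc u)) \<sigma>"
    by (rule big_disj)
  with Suc.IH show ?case by (meson less_SucI lessI)
qed simp

text \<open>If all \<open>l m\<close> successors of a string were big, the string itself would be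
  big, as \<open>k \<le> l m\<close>. So some successor is small, and this repeats up to any
  level.\<close>

lemma small_extension:
  assumes "\<not> big l k B \<sigma>" "bounded_string l \<sigma>" "mono l" "k \<le> l (length \<sigma>)" "length \<sigma> \<le> m"
  shows "\<exists>\<rho>. \<not> big l k B (\<rho> @ \<sigma>) \<and> bounded_string l (\<rho> @ \<sigma>) \<and> length (\<rho> @ \<sigma>) = m"
  using assms(5)
proof (induction m rule: dec_induct)
  case base
  show ?case using assms by (intro exI[of _ "[]"]) simp
next
  case (step m)
  then obtain \<rho> where \<rho>: "\<not> big l k B (\<rho> @ \<sigma>)" "bounded_string l (\<rho> @ \<sigma>)" "length (\<rho> @ \<sigma>) = m"
    by blast
  have "k \<le> l m" using assms(3,4) step(1) by (meson le_trans monoD)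
  then obtain j where "j < l m" "\<not> big l k B (j # \<rho> @ \<sigma>)"
    using \<rho>(1,3) big.node[of "{..<l m}" l "\<rho> @ \<sigma>" k B] by auto
  with \<rho> show ?case by (intro exI[of _ "j # \<rho>"]) auto
qed

text \<open>\<open>x\<close> codes the parameters \<open>\<langle>c, \<langle>y, \<langle>v, k\<rangle>\<rangle>\<rangle>\<close> of the set of strings on which program \<open>c\<close>
  at input \<open>y\<close> has output \<open>v\<close>. Conclusions have the form \<open>\<langle>x, s\<rangle>\<close>.\<close>

definition big_rule :: "(nat \<Rightarrow> nat) \<Rightarrow> (nat \<Rightarrow> bool) \<Rightarrow> nat \<Rightarrow> nat \<Rightarrow> nat \<Rightarrow> nat \<Rightarrow> bool" where
  "big_rule l D a P x s \<longleftrightarrow>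
     D \<langle>\<langle>s, x\<rangle>, a\<rangle> \<or>
     (code_len P = psnd (psnd (psnd x)) \<and>
       (\<forall>i<code_len P. code_nth P i = \<langle>x, Suc \<langle>code_nth a i, s\<rangle>\<rangle> \<and>
          code_nth a i < l (code_len s) \<and> (\<forall>i'<i. \<not> code_nth a i' = code_nth a i)))"

text \<open>Bigness is generated by a derivation system whose leaves carry, in \<open>a\<close>, a
  witness of the enumerable leaf condition; this keeps the rules decidable.\<close>

lemma re_big:
  assumes l: "total_recursive l"
    and rec: "total_recursive c" "total_recursive y" "total_recursive v" "total_recursive k"
      "total_recursive s"
  shows "re (\<lambda>n. big l (k n) (\<lambda>\<tau>. ev (str_oracle \<tau>) (c n) (y n) (v n)) (list_decode (s n)))"
proof -
  have "re (\<lambda>n. ev (str_oracle (list_decode (pfst n))) (pfst (psnd n)) (pfst (psnd (psnd n)))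
     (pfst (psnd (psnd (psnd n)))))"
    by (intro re_ev rec_intros)
  then obtain D where D: "decidable D"
    "\<And>n. ev (str_oracle (list_decode (pfst n))) (pfst (psnd n)) (pfst (psnd (psnd n)))
     (pfst (psnd (psnd (psnd n)))) \<longleftrightarrow> (\<exists>w. D \<langle>n, w\<rangle>)"
    unfolding re_def by meson
  define S where "S a P n = big_rule l D a P (pfst n) (psnd n)" for a P n
  have "decidable (\<lambda>n. S (f n) (g n) (h n))"
    if "total_recursive f" "total_recursive g" "total_recursive h" for f g h
    unfolding S_def big_rule_def
    by (intro rec_intros that that[THEN rec_comp] decidable_subst[OF D(1)] rec_comp[OF l])
  then have reS: "re (derivable S)" by (rule re_derivable)
  have "derivable S \<langle>\<langle>c, \<langle>y, \<langle>v, k\<rangle>\<rangle>\<rangle>, s\<rangle> \<longleftrightarrow>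
    big l k (\<lambda>\<tau>. ev (str_oracle \<tau>) c y v) (list_decode s)" (is "derivable S \<langle>?x, s\<rangle> = big l k ?A _") for c y v k s
  proof
    have "n = \<langle>?x, s\<rangle> \<Longrightarrow> big l k ?A (list_decode s)" if "derivable S n" for n s
      using that
    proof (induction arbitrary: s rule: derivable.induct)
      case (1 a P n)
      have rule: "big_rule l D a P ?x s" using 1(1) unfolding S_def 1(4) by (simp only: pfst_pair psnd_pair)
      show ?case
      proof (cases "D \<langle>\<langle>s, ?x\<rangle>, a\<rangle>")
        case True
        then have "?A (list_decode s)"
          using D(2)[of "\<langle>s, ?x\<rangle>"] unfolding pfst_pair psnd_pair by meson
        then show ?thesis by (rule big.leaf)
      next
        case False
        note conj = mp[OF rule[unfolded big_rule_def psnd_pair disj_imp] False]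
        note len = conjunct1[OF conj]
        have nth: "\<And>i. i < k \<Longrightarrow> code_nth P i = \<langle>?x, Suc \<langle>code_nth a i, s\<rangle>\<rangle>"
            "\<And>i. i < k \<Longrightarrow> code_nth a i < l (length (list_decode s))"
            "\<And>i i'. i < k \<Longrightarrow> i' < i \<Longrightarrow> code_nth a i' \<noteq> code_nth a i"
          using conjunct2[OF conj, unfolded len, unfolded code_len_def] by meson+
        show ?thesis
        proof (rule big.node[of "code_nth a ` {..<k}"])
          show "code_nth a ` {..<k} \<subseteq> {..<l (length (list_decode s))}" using nth(2) by auto
          have "inj_on (code_nth a) {..<k}"
            using nth(3) by (intro linorder_inj_onI) auto
          then show "k \<le> card (code_nth a ` {..<k})" by (simp add: card_image)
          fix j assume "j \<in> code_nth a ` {..<k}"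
          then obtain i where i: "i < k" "j = code_nth a i" by blast
          with len have "code_nth P i \<in> set (list_decode P)"
            by (simp add: code_nth_def code_len_def)
          from 1(3)[OF this nth(1)[OF i(1)]] show "big l k ?A (j # list_decode s)"
            by (simp add: i(2))
        qed
      qed
    qed
    then show "derivable S \<langle>?x, s\<rangle> \<Longrightarrow> big l k ?A (list_decode s)" by blast
  next
    assume "big l k ?A (list_decode s)"
    moreover have "derivable S \<langle>?x, list_encode \<sigma>\<rangle>" if "big l k ?A \<sigma>" for \<sigma>
      using that
    proof induction
      case (leaf \<sigma>)
      then have "\<exists>w. D \<langle>\<langle>list_encode \<sigma>, ?x\<rangle>, w\<rangle>"
        using D(2)[of "\<langle>list_encode \<sigma>, ?x\<rangle>"]
        by (simp only: pfst_pair psnd_pair list_encode_inverse)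
      then obtain w where "D \<langle>\<langle>list_encode \<sigma>, ?x\<rangle>, w\<rangle>" ..
      then show ?case
        by (intro derivable_list[of _ w "[]"]) (simp_all add: S_def big_rule_def)
    next
      case (node J \<sigma>)
      \<comment> \<open>A node may have more than \<open>k\<close> successors, whereas a rule
        instance lists exactly \<open>k\<close> of them.\<close>
      obtain J' where J': "J' \<subseteq> J" "card J' = k" "finite J'"
        using node(2) by (meson obtain_subset_with_card_n)
      define js where "js = sorted_list_of_set J'"
      have js: "set js = J'" "distinct js" "length js = k"
        using J' by (simp_all add: js_def)
      let ?P = "map (\<lambda>j. \<langle>?x, Suc \<langle>j, list_encode \<sigma>\<rangle>\<rangle>) js"
      show ?case
      proof (rule derivable_list[of _ "list_encode js" ?P])
        have "js ! i < l (length \<sigma>)" if "i < k" for i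
          using that js node(1) J'(1) nth_mem[of i js] by auto
        then show "S (list_encode js) (list_encode ?P) \<langle>?x, list_encode \<sigma>\<rangle>"
          using js(2,3) by (simp add: S_def big_rule_def nth_eq_iff_index_eq)
        show "\<forall>m\<in>set ?P. derivable S m" using js(1) J'(1) node(4) by auto
      qed
    qed
    ultimately show "derivable S \<langle>?x, s\<rangle>" by (metis list_decode_inverse)
  qed
  moreover have "re (\<lambda>n. derivable S \<langle>\<langle>c n, \<langle>y n, \<langle>v n, k n\<rangle>\<rangle>\<rangle>, s n\<rangle>)"
    by (intro re_subst[OF reS] rec_intros rec)
  ultimately show ?thesis by simp
qed

section \<open>Forcing with bushy trees\<close>

text \<open>The argument \<open>x\<close> at which a partial recursive function acts against one
  requirement. It records \<open>a\<close> and \<open>b\<close> because the value has to suit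
  position \<open>a * x + b\<close>, where a linearly universal function copies the value at
  \<open>x\<close>.\<close>

definition req_code :: "nat \<Rightarrow> nat \<Rightarrow> nat \<Rightarrow> nat \<Rightarrow> nat list \<Rightarrow> nat" where
  "req_code c a b k \<sigma> = \<langle>c, \<langle>a, \<langle>b, \<langle>k, list_encode \<sigma>\<rangle>\<rangle>\<rangle>\<rangle>"

text \<open>From \<open>x\<close> the whole requirement can be decoded, so \<open>a * x + b\<close>
  is known and a value forced on a big set can be searched for by enumerating bigness.\<close>

lemma bushy_value_selector:
  assumes "total_recursive l"
  obtains \<theta> where "partial_recursive \<theta>"
    "\<And>c a b k \<sigma> v. big l k (\<lambda>\<tau>. ev (str_oracle \<tau>) c (a * req_code c a b k \<sigma> + b) v) \<sigma> \<Longrightarrow>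
       \<exists>w. \<theta> (req_code c a b k \<sigma>) = Some w \<and>
         big l k (\<lambda>\<tau>. ev (str_oracle \<tau>) c (a * req_code c a b k \<sigma> + b) w) \<sigma>"
proof -
  define R where "R x v \<longleftrightarrow> big l (pfst (psnd (psnd (psnd x))))
    (\<lambda>\<tau>. ev (str_oracle \<tau>) (pfst x) (pfst (psnd x) * x + pfst (psnd (psnd x))) v)
    (list_decode (psnd (psnd (psnd (psnd x)))))" for x v
  have "re (\<lambda>n. R (pfst n) (psnd n))"
    unfolding R_def by (intro re_big assms rec_intros)
  then obtain \<theta> where \<theta>: "partial_recursive \<theta>" "\<And>x v. \<theta> x = Some v \<Longrightarrow> R x v"
    "\<And>x v. R x v \<Longrightarrow> \<theta> x \<noteq> None"
    by (rule re_uniformization) (rule that)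
  have sel: "\<exists>w. \<theta> x = Some w \<and> R x w" if "R x v" for x v
    using \<theta>(2,3) that by (meson not_None_eq)
  have R: "R (req_code c a b k \<sigma>) v \<longleftrightarrow>
      big l k (\<lambda>\<tau>. ev (str_oracle \<tau>) c (a * req_code c a b k \<sigma> + b) v) \<sigma>" for c a b k \<sigma> v
    by (simp add: R_def req_code_def)
  show ?thesis by (rule that[OF \<theta>(1)]) (use sel in \<open>simp only: R[symmetric]\<close>)
qed

lemma bounded_string_nth: "bounded_string l \<sigma> \<Longrightarrow> i < length \<sigma> \<Longrightarrow> rev \<sigma> ! i < l i"
  by (induction \<sigma>) (auto simp: nth_append less_Suc_eq)

lemma bounded_string_replicate_0: "(\<And>n. 0 < l n) \<Longrightarrow> bounded_string l (replicate m 0)"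
  by (induction m) auto

text \<open>A string that nowhere agrees with \<open>\<psi>\<close> has at most one immediate
  successor that does, so a 2-branching tree cannot have all its leaves in agreement unless its root
  already agrees.\<close>

lemma diagonal_strings_small:
  assumes "\<And>n. n < m \<Longrightarrow> \<psi> n = None" "length \<sigma> = m"
  shows "\<not> big l 2 (\<lambda>\<tau>. \<exists>n<length \<tau>. \<psi> n = Some (rev \<tau> ! n)) \<sigma>"
proof -
  let ?B = "\<lambda>\<tau>. \<exists>n<length \<tau>. \<psi> n = Some (rev \<tau> ! n)"
  have "?B \<tau>" if "big l 2 ?B \<tau>" for \<tau>
    using that
  proof induction
    case (node J \<tau>)
    show ?case
    proof (rule ccontr)
      assume not: "\<not> ?B \<tau>"
      \<comment> \<open>The new agreement can only be at the last position, so \<open>j\<close> is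
        the value of \<open>\<psi>\<close> there. If \<open>\<psi>\<close> is undefined there,
        \<open>J\<close> is empty and the default of \<open>the\<close> is harmless.\<close>
      have "j \<in> {the (\<psi> (length \<tau>))}" if "j \<in> J" for j
      proof -
        from node(4)[OF that] obtain n where n: "n < Suc (length \<tau>)" "\<psi> n = Some (rev (j # \<tau>) ! n)"
          by auto
        with not have "n = length \<tau>" by (metis less_SucE length_rev nth_append rev.simps(2))
        with n(2) show ?thesis by (simp add: nth_append)
      qed
      then have "J \<subseteq> {the (\<psi> (length \<tau>))}" by (rule subsetI)
      then have "card J \<le> 1" using card_mono[of "{the (\<psi> (length \<tau>))}" J] by simp
      with node(2) show False by simp
    qed
  qed
  moreover have "\<not> ?B \<sigma>" using assms by simp
  ultimately show ?thesis by meson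
qed

text \<open>In \<open>room\<close>, a level \<open>m\<close> must leave room for a \<open>k\<close>-small set together with one that is
  small for \<open>k\<close> times the number \<open>u y + 1\<close> of admissible values at \<open>y\<close>: \<open>k + k * (u y + 1) \<le> l m\<close>.\<close>

theorem not_weakly_reducible_LUA:
  fixes l u :: "nat \<Rightarrow> nat" and p r :: "nat \<Rightarrow> real"
  assumes l: "total_recursive l" "mono l" "\<And>n. 0 < l n"
    and lp: "\<And>n. real (l n) \<le> p n" and ru: "\<And>n. r n \<le> real (u n)"
    and room: "\<And>K. \<exists>m\<ge>K. \<forall>\<sigma> c a b k. bounded_string l \<sigma> \<longrightarrow> length \<sigma> = m \<longrightarrow>
      c \<le> K \<longrightarrow> a \<le> K \<longrightarrow> b \<le> K \<longrightarrow> k \<le> K \<longrightarrow> k * (u (a * req_code c a b k \<sigma> + b) + 2) \<le> l m"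
  shows "\<not> LUA r \<le>\<^sub>w LUA p"
proof
  obtain \<theta> where \<theta>: "partial_recursive \<theta>"
    "\<And>c a b k \<sigma> v. big l k (\<lambda>\<tau>. ev (str_oracle \<tau>) c (a * req_code c a b k \<sigma> + b) v) \<sigma> \<Longrightarrow>
       \<exists>w. \<theta> (req_code c a b k \<sigma>) = Some w \<and>
         big l k (\<lambda>\<tau>. ev (str_oracle \<tau>) c (a * req_code c a b k \<sigma> + b) w) \<sigma>"
    using bushy_value_selector[OF l(1)] by metis
  \<comment> \<open>The clause \<open>k \<le> l (length \<sigma>)\<close> leaves enough successors
    to extend the string while \<open>B\<close> stays small.\<close>
  define good where "good \<sigma> B k \<longleftrightarrow> bounded_string l \<sigma> \<and> \<not> big l k B \<sigma> \<and> k \<le> l (length \<sigma>)"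
    for \<sigma> B k
  \<comment> \<open>Either program \<open>c\<close> hits \<open>\<theta>\<close> at a position
    copied by any linearly universal function with coefficients \<open>a\<close>, \<open>b\<close>,
    or all strings giving an admissible value at \<open>y\<close> are forbidden.\<close>
  define forces where "forces c a b \<sigma> B \<longleftrightarrow>
    (\<exists>x v. \<theta> x = Some v \<and> ev (str_oracle \<sigma>) c (a * x + b) v) \<or>
    (\<exists>y. \<forall>\<tau> v. v \<le> u y \<longrightarrow> ev (str_oracle \<tau>) c y v \<longrightarrow> B \<tau>)" for c a b \<sigma> B
  have step: "\<exists>\<sigma>' B' k'. good \<sigma>' B' k' \<and> suffix \<sigma> \<sigma>' \<and> j \<le> length \<sigma>' \<and>
      (\<forall>\<tau>. B \<tau> \<longrightarrow> B' \<tau>) \<and> forces c a b \<sigma>' B'"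
    if gd: "good \<sigma> B k" for \<sigma> B k j c a b
  proof -
    \<comment> \<open>The sum dominates all parameters, the current length and the target length, so
      one level from \<open>room\<close> serves them all.\<close>
    define K where "K = c + a + b + k + length \<sigma> + j"
    obtain m where m: "K \<le> m" "\<And>\<sigma>. bounded_string l \<sigma> \<Longrightarrow> length \<sigma> = m \<Longrightarrow>
        k * (u (a * req_code c a b k \<sigma> + b) + 2) \<le> l m"
    proof -
      have "c \<le> K" "a \<le> K" "b \<le> K" "k \<le> K" by (simp_all add: K_def)
      then show ?thesis using room[of K] that by meson
    qed
    have "length \<sigma> \<le> m" "j \<le> m" using m(1) by (simp_all add: K_def)
    \<comment> \<open>The string is lengthened before the code \<open>x\<close> is formed, since
      \<open>x\<close> depends on the string at level \<open>m\<close>.\<close>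
    obtain \<rho> where \<rho>: "\<not> big l k B (\<rho> @ \<sigma>)" "bounded_string l (\<rho> @ \<sigma>)" "length (\<rho> @ \<sigma>) = m"
      using small_extension[of l k B \<sigma> m] gd \<open>length \<sigma> \<le> m\<close> l(2) unfolding good_def by meson
    define \<sigma>' where "\<sigma>' = \<rho> @ \<sigma>"
    note \<sigma>' = \<rho>[folded \<sigma>'_def]
    define x where "x = req_code c a b k \<sigma>'"
    define y where "y = a * x + b"
    define A where "A \<tau> \<longleftrightarrow> (\<exists>v<Suc (u y). ev (str_oracle \<tau>) c y v)" for \<tau>
    have bound: "k * (u y + 2) \<le> l m" using m(2)[OF \<sigma>'(2,3)] by (simp add: x_def y_def)
    show ?thesis
    proof (cases "big l (k * Suc (u y)) A \<sigma>'")
      case True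
      from big_pigeonhole[OF this[unfolded A_def]] obtain v where
        "big l k (\<lambda>\<tau>. ev (str_oracle \<tau>) c y v) \<sigma>'" by meson
      \<comment> \<open>The selected \<open>w\<close> may differ from the \<open>v\<close> found by
        pigeonhole, but it is forced on a \<open>k\<close>-big set as well.\<close>
      from \<theta>(2)[OF this[unfolded y_def x_def]] obtain w where w: "\<theta> x = Some w"
        "big l k (\<lambda>\<tau>. ev (str_oracle \<tau>) c y w) \<sigma>'" unfolding y_def x_def by meson
      define G where "G \<tau> \<longleftrightarrow> ev (str_oracle \<tau>) c y w \<and> bounded_string l \<tau> \<and> suffix \<sigma>' \<tau>" for \<tau>
      have "big l k G \<sigma>'"
        unfolding G_def using w(2) \<sigma>'(2) by (rule big_extensions)
      \<comment> \<open>If \<open>B\<close> were big above every string of \<open>G\<close>,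
        grafting would make \<open>B\<close> big above \<open>\<sigma>'\<close>.\<close>
      then have "\<exists>\<tau>. G \<tau> \<and> \<not> big l k B \<tau>"
        using big_trans[of l k G \<sigma>' B] \<sigma>'(1) by meson
      then obtain \<tau> where "G \<tau>" and small: "\<not> big l k B \<tau>" by meson
      then have \<tau>: "ev (str_oracle \<tau>) c y w" "bounded_string l \<tau>" "suffix \<sigma>' \<tau>"
        by (simp_all only: G_def)
      have suf: "suffix \<sigma> \<tau>"
        using \<tau>(3) by (rule suffix_order.trans[rotated]) (simp add: \<sigma>'_def suffix_def)
      have "k \<le> l (length \<sigma>)" using gd by (simp add: good_def)
      also have "\<dots> \<le> l (length \<tau>)" by (intro monoD[OF l(2)] suffix_length_le suf)
      finally have "good \<tau> B k" using \<tau>(2) small by (simp add: good_def)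
      moreover note suf
      moreover have "j \<le> length \<tau>"
        using \<open>j \<le> m\<close> \<sigma>'(3) suffix_length_le[OF \<tau>(3)] by simp
      moreover have "forces c a b \<tau> B" unfolding forces_def using w(1) \<tau>(1)[unfolded y_def] by meson
      ultimately show ?thesis by meson
    next
      case False
      define B' where "B' \<tau> \<longleftrightarrow> B \<tau> \<or> A \<tau>" for \<tau>
      \<comment> \<open>The new smallness parameter equals \<open>k * (u y + 2)\<close>, exactly
        what \<open>room\<close> bounds by \<open>l m\<close>.\<close>
      have "\<not> big l (k + k * Suc (u y)) B' \<sigma>'"
        using big_disj[of l k "k * Suc (u y)" B A \<sigma>'] False \<sigma>'(1) unfolding B'_def by meson
      then have "good \<sigma>' B' (k + k * Suc (u y))"
        using \<sigma>' bound by (simp add: good_def algebra_simps)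
      moreover have "forces c a b \<sigma>' B'" unfolding forces_def B'_def A_def
        by (intro disjI2) (meson le_imp_less_Suc)
      moreover have "j \<le> length \<sigma>'" using \<open>j \<le> m\<close> \<sigma>'(3) by simp
      moreover have "\<forall>\<tau>. B \<tau> \<longrightarrow> B' \<tau>" by (simp add: B'_def)
      moreover have "suffix \<sigma> \<sigma>'" by (simp add: \<sigma>'_def suffix_def)
      ultimately show ?thesis by meson
    qed
  qed
  obtain m where m: "2 \<le> l m"
  proof -
    from room[of 2] obtain m where m: "2 \<le> m" "\<forall>\<sigma> c a b k. bounded_string l \<sigma> \<longrightarrow> length \<sigma> = m \<longrightarrow>
      c \<le> 2 \<longrightarrow> a \<le> 2 \<longrightarrow> b \<le> 2 \<longrightarrow> k \<le> 2 \<longrightarrow> k * (u (a * req_code c a b k \<sigma> + b) + 2) \<le> l m" by meson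
    \<comment> \<open>With \<open>k = 2\<close> and the other parameters 0, the bound reads
      \<open>2 * (u 0 + 2) \<le> l m\<close>.\<close>
    from m(2)[rule_format, of "replicate m 0" 0 0 0 2] show ?thesis
      using bounded_string_replicate_0[of l m, OF l(3)] that[of m] by simp
  qed
  obtain \<psi> where \<psi>: "linearly_universal \<psi>" "\<And>n. n < m \<Longrightarrow> \<psi> n = None"
    by (rule linearly_universal_exists[of m]) (rule that)
  define B0 where "B0 \<tau> \<longleftrightarrow> (\<exists>n<length \<tau>. \<psi> n = Some (rev \<tau> ! n))" for \<tau>
  have "good (replicate m 0) B0 2"
    using m diagonal_strings_small[of m \<psi> "replicate m 0" l, OF \<psi>(2)]
      bounded_string_replicate_0[of l m, OF l(3)]
    by (simp add: good_def B0_def[abs_def])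
  define P :: "nat \<Rightarrow> nat list \<times> (nat list \<Rightarrow> bool) \<times> nat \<Rightarrow> bool" where
    "P j s \<longleftrightarrow> good (fst s) (fst (snd s)) (snd (snd s)) \<and> (\<forall>\<tau>. B0 \<tau> \<longrightarrow> fst (snd s) \<tau>)" for j s
  \<comment> \<open>Stage \<open>j\<close> treats the triple that \<open>j\<close> codes, so every
    program with every pair of coefficients gets its stage.\<close>
  define N :: "nat \<Rightarrow> nat list \<times> (nat list \<Rightarrow> bool) \<times> nat \<Rightarrow> nat list \<times> (nat list \<Rightarrow> bool) \<times> nat \<Rightarrow> bool"
    where "N j s s' \<longleftrightarrow> suffix (fst s) (fst s') \<and> j \<le> length (fst s') \<and>
      (\<forall>\<tau>. fst (snd s) \<tau> \<longrightarrow> fst (snd s') \<tau>) \<and>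
      forces (pfst j) (pfst (psnd j)) (psnd (psnd j)) (fst s') (fst (snd s'))" for j s s'
  have "\<exists>f. \<forall>n. P n (f n) \<and> N n (f n) (f (Suc n))"
  proof (rule dependent_nat_choice)
    show "\<exists>s. P 0 s"
      using \<open>good (replicate m 0) B0 2\<close> by (intro exI[of _ "(replicate m 0, B0, 2)"]) (simp add: P_def)
    fix s j assume P: "P j s"
    then have "good (fst s) (fst (snd s)) (snd (snd s))" by (simp add: P_def)
    from step[OF this, of j "pfst j" "pfst (psnd j)" "psnd (psnd j)"] obtain \<sigma> B k where
      *: "good \<sigma> B k" "suffix (fst s) \<sigma>" "j \<le> length \<sigma>" "\<forall>\<tau>. fst (snd s) \<tau> \<longrightarrow> B \<tau>"
        "forces (pfst j) (pfst (psnd j)) (psnd (psnd j)) \<sigma> B"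
      by meson
    have "P (Suc j) (\<sigma>, B, k)" using P * by (simp add: P_def)
    moreover have "N j s (\<sigma>, B, k)" using * by (simp add: N_def)
    ultimately show "\<exists>s'. P (Suc j) s' \<and> N j s s'" by (intro exI conjI)
  qed
  then obtain f where f: "\<And>n. P n (f n)" "\<And>n. N n (f n) (f (Suc n))" by meson
  define \<sigma> where "\<sigma> n = fst (f n)" for n
  define B where "B n = fst (snd (f n))" for n
  have bnd: "bounded_string l (\<sigma> n)" and B0: "B0 \<tau> \<Longrightarrow> B n \<tau>" for n \<tau>
    using f(1)[of n] by (simp_all add: P_def good_def \<sigma>_def B_def)
  \<comment> \<open>A string in \<open>B\<close> would be a one-leaf tree, making \<open>B\<close>
    big above it.\<close>
  have notB: "\<not> B n (\<sigma> n)" for n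
    using f(1)[of n] big.leaf[of "B n" "\<sigma> n" l] by (auto simp: P_def good_def \<sigma>_def B_def)
  have N: "suffix (\<sigma> n) (\<sigma> (Suc n))" "n \<le> length (\<sigma> (Suc n))" "B n \<tau> \<Longrightarrow> B (Suc n) \<tau>"
    "forces (pfst n) (pfst (psnd n)) (psnd (psnd n)) (\<sigma> (Suc n)) (B (Suc n))" for n \<tau>
    using f(2)[of n] by (simp_all add: N_def \<sigma>_def B_def)
  have chain: "suffix (\<sigma> n) (\<sigma> n')" if "n \<le> n'" for n n'
    using that
  proof (induction n' rule: dec_induct)
    case (step n')
    from step(3) N(1)[of n'] show ?case by (rule suffix_order.trans)
  qed simp
  have Bmono: "B n' \<tau>" if "n \<le> n'" "B n \<tau>" for n n' \<tau>
    using that(1) by (induction n' rule: dec_induct) (use that(2) N(3) in simp_all)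
  have nth: "rev (\<sigma> n) ! i = rev (\<sigma> n') ! i" if "i < length (\<sigma> n)" "i < length (\<sigma> n')" for i n n'
  proof -
    have "rev (\<sigma> n) ! i = rev (\<sigma> n') ! i" if le: "n \<le> n'" and lt: "i < length (\<sigma> n)" for n n'
    proof -
      obtain \<rho> where "\<sigma> n' = \<rho> @ \<sigma> n"
        using chain[OF le] by (rule suffixE)
      with lt show ?thesis by (simp add: nth_append)
    qed
    with that show ?thesis by (metis nle_le)
  qed
  \<comment> \<open>Stage \<open>Suc n\<close> only guarantees length \<open>n\<close>, so position
    \<open>n\<close> is first sure to exist two stages later.\<close>
  define Y where "Y n = rev (\<sigma> (Suc (Suc n))) ! n" for n
  have len: "n < length (\<sigma> (Suc (Suc n)))" for n using N(2)[of "Suc n"] by simp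
  have Y: "Y i = rev (\<sigma> n) ! i" if "i < length (\<sigma> n)" for i n
    unfolding Y_def by (rule nth) (use len that in simp_all)
  have initial: "str_oracle (\<sigma> n) = prefix_oracle Y (length (\<sigma> n))" for n
    by (intro ext) (auto simp: str_oracle_def prefix_oracle_def Y)
  have "Y \<in> LUA p"
  proof -
    have "real (Y n) < p n" for n
    proof -
      have "Y n < l n" unfolding Y_def by (rule bounded_string_nth[OF bnd len])
      then show ?thesis using lp[of n] by linarith
    qed
    moreover have "\<psi> n \<noteq> Some (Y n)" for n
    proof
      assume "\<psi> n = Some (Y n)"
      then have "B0 (\<sigma> (Suc (Suc n)))" unfolding B0_def Y_def using len[of n] by meson
      with B0 notB show False by meson
    qed
    ultimately show ?thesis using \<psi>(1) unfolding LUA_def by blast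
  qed
  moreover assume "LUA r \<le>\<^sub>w LUA p"
  ultimately obtain X where "X \<in> LUA r" and X: "turing_computes Y X"
    unfolding weakly_reducible_def by blast
  then obtain \<psi>' where Xr: "\<And>n. real (X n) < r n" and \<psi>': "linearly_universal \<psi>'"
    "\<And>n. \<psi>' n \<noteq> Some (X n)"
    unfolding LUA_def by blast
  obtain a b where ab: "\<And>x. \<psi>' (a * x + b) = \<theta> x"
    using \<psi>'(1) \<theta>(1) unfolding linearly_universal_def by meson
  have "\<exists>c. \<forall>x v. ev (\<lambda>n v. v = Y n) c x v \<longleftrightarrow> Some (X x) = Some v"
    using X unfolding turing_computes_def by (rule ev_complete) simp
  then obtain c where c: "\<And>x v. ev (\<lambda>n v. v = Y n) c x v \<longleftrightarrow> X x = v" by auto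
  let ?j = "\<langle>c, \<langle>a, b\<rangle>\<rangle>"
  have "forces c a b (\<sigma> (Suc ?j)) (B (Suc ?j))" using N(4)[of ?j] by simp
  then show False unfolding forces_def
  proof (elim disjE exE conjE)
    fix x v assume xv: "\<theta> x = Some v" "ev (str_oracle (\<sigma> (Suc ?j))) c (a * x + b) v"
    from xv(2) have "ev (\<lambda>n v. v = Y n) c (a * x + b) v"
      by (rule ev_mono) (simp add: initial prefix_oracle_def)
    then have "\<psi>' (a * x + b) = Some (X (a * x + b))" using xv(1) by (simp add: c ab)
    with \<psi>'(2) show False ..
  next
    fix y assume y: "\<forall>\<tau> v. v \<le> u y \<longrightarrow> ev (str_oracle \<tau>) c y v \<longrightarrow> B (Suc ?j) \<tau>"
    have "X y \<le> u y" using Xr[of y] ru[of y] by linarith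
    have "ev (\<lambda>n v. v = Y n) c y (X y)" by (simp add: c)
    then obtain n where n: "ev (prefix_oracle Y n) c y (X y)" using ev_use by meson
    \<comment> \<open>Late enough for the string to contain the use of the computation and for the
      forbidden set of stage \<open>Suc ?j\<close> to be included.\<close>
    define i where "i = max (Suc ?j) (Suc n)"
    have "n \<le> length (\<sigma> i)"
      using suffix_length_le[OF chain[of "Suc n" i]] N(2)[of n] by (simp add: i_def)
    with n have "ev (str_oracle (\<sigma> i)) c y (X y)" unfolding initial by (rule ev_prefix_mono)
    with y \<open>X y \<le> u y\<close> have "B (Suc ?j) (\<sigma> i)" by meson
    then have "B i (\<sigma> i)" by (intro Bmono[of "Suc ?j" i]) (simp_all add: i_def)
    with notB show False ..
  qed
qed

section \<open>A step function with long plateaus and large jumps\<close>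

lemma decidable_le [rec_intros]:
  assumes "total_recursive f" "total_recursive g"
  shows "decidable (\<lambda>n. f n \<le> g n)"
proof -
  have "decidable (\<lambda>n. \<not> g n < f n)" by (intro rec_intros assms)
  then show ?thesis by (simp add: not_less)
qed

text \<open>The quotient is the least \<open>t\<close> with \<open>a < Suc t * b\<close>; the extra
  disjunct makes the search return 0 for divisor 0.\<close>

lemma rec_div [rec_intros]:
  assumes "total_recursive f" "total_recursive g"
  shows "total_recursive (\<lambda>n. f n div g n)"
proof -
  have *: "b = 0 \<or> a < Suc t * b \<longleftrightarrow> b = 0 \<or> a div b \<le> t" for a b t :: nat
    using div_less_iff_less_mult[of b a "Suc t"] by (cases "b = 0") (simp_all add: less_Suc_eq_le)
  have "(LEAST t. b = 0 \<or> a < Suc t * b) = a div b" for a b :: nat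
    unfolding * by (rule Least_equality) auto
  moreover have "total_recursive (\<lambda>n. LEAST t. g n = 0 \<or> f n < Suc t * g n)"
  proof (rule rec_Least)
    show "\<exists>t. g n = 0 \<or> f n < Suc t * g n" for n unfolding * by blast
  qed (intro rec_intros rec_comp[OF assms(1)] rec_comp[OF assms(2)])
  ultimately show ?thesis by simp
qed

section \<open>Bounds on the positions attacked by requirements\<close>

lemma prod_encode_mono: "a \<le> a' \<Longrightarrow> b \<le> b' \<Longrightarrow> \<langle>a, b\<rangle> \<le> \<langle>a', b'\<rangle>"
  by (auto simp: prod_encode_def triangle_def intro!: add_mono div_le_mono mult_le_mono)

lemma list_encode_le_replicate:
  "\<forall>x\<in>set xs. x \<le> M \<Longrightarrow> list_encode xs \<le> list_encode (replicate (length xs) M)"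
  by (induction xs) (simp_all add: prod_encode_mono)

lemma rec_encode_replicate:
  assumes "total_recursive f" "total_recursive g"
  shows "total_recursive (\<lambda>n. list_encode (replicate (f n) (g n)))"
proof -
  have "rec_nat 0 (\<lambda>i r. Suc \<langle>M, r\<rangle>) m = list_encode (replicate m M)" for m M
    by (induction m) auto
  moreover have "total_recursive (\<lambda>n. rec_nat 0 (\<lambda>i r. Suc \<langle>g n, r\<rangle>) (f n))"
    by (intro rec_intros assms rec_comp[OF assms(2)])
  ultimately show ?thesis by simp
qed

text \<open>Obtained from \<open>a * req_code c a b k \<sigma> + b\<close> by raising all parameters
  to \<open>K\<close> and all \<open>m\<close> entries of the string to \<open>M\<close>.\<close>

definition code_bound :: "nat \<Rightarrow> nat \<Rightarrow> nat \<Rightarrow> nat" where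
  "code_bound K m M = K * \<langle>K, \<langle>K, \<langle>K, \<langle>K, list_encode (replicate m M)\<rangle>\<rangle>\<rangle>\<rangle> + K"

lemma rec_code_bound [rec_intros]:
  assumes "total_recursive f" "total_recursive g" "total_recursive h"
  shows "total_recursive (\<lambda>n. code_bound (f n) (g n) (h n))"
  unfolding code_bound_def by (intro rec_intros rec_encode_replicate assms)

lemma bounded_string_set:
  "bounded_string l \<sigma> \<Longrightarrow> (\<And>i. i < length \<sigma> \<Longrightarrow> l i \<le> M) \<Longrightarrow> x \<in> set \<sigma> \<Longrightarrow> x \<le> M"
proof (induction \<sigma>)
  case (Cons j \<sigma>)
  have "j \<le> M" using Cons.prems(1) Cons.prems(2)[of "length \<sigma>"] by simp
  with Cons show ?case by auto
qed simp

lemma req_code_bound: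
  assumes "bounded_string l \<sigma>" "\<And>i. i < length \<sigma> \<Longrightarrow> l i \<le> M" "c \<le> K" "a \<le> K" "b \<le> K" "k \<le> K"
  shows "a * req_code c a b k \<sigma> + b \<le> code_bound K (length \<sigma>) M"
  unfolding req_code_def code_bound_def
  by (intro add_mono mult_le_mono prod_encode_mono list_encode_le_replicate assms ballI)
    (rule bounded_string_set[OF assms(1,2)])

section \<open>The step function, its growth and the two non-reductions\<close>

text \<open>In the application \<open>l\<close> lies below \<open>p2\<close> and \<open>U\<close>
  above \<open>p1\<close>.\<close>

locale step_function =
  fixes l U :: "nat \<Rightarrow> nat"
  assumes rec_l: "total_recursive l" and mono_l: "mono l" and l_unbounded: "\<And>M. \<exists>n. M \<le> l n"
    and rec_U: "total_recursive U"
begin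

text \<open>A level at which \<open>l\<close> has room for parameters up to \<open>j\<close> when
  the admissible values are governed by \<open>v\<close>.\<close>

definition low :: "nat \<Rightarrow> nat \<Rightarrow> nat" where
  "low j v = (LEAST m. j \<le> m \<and> j * (v + 2) \<le> l m)"

text \<open>The plateau with value \<open>v\<close> starting at \<open>n\<close> extends past every
  position attacked from level \<open>low j v\<close>. The summand \<open>v\<close> makes it long
  enough to add at least 1 to the sum of reciprocals.\<close>

definition next_start :: "nat \<Rightarrow> nat \<Rightarrow> nat \<Rightarrow> nat" where
  "next_start j n v = Suc (n + v + code_bound j (low j v) (l (low j v)))"

text \<open>The jump at the new start \<open>n\<close> leaves room for parameters up to
  \<open>n\<close>: the attacked positions are bounded using only the old value \<open>v\<close>,
  since strings of length \<open>n\<close> have entries below it.\<close>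

definition next_value :: "nat \<Rightarrow> nat \<Rightarrow> nat" where
  "next_value n v = Suc (v + n * (U (code_bound n n v) + 2))"

definition plateau :: "nat \<Rightarrow> nat" where
  "plateau j = rec_nat \<langle>0, 2\<rangle> (\<lambda>i r. \<langle>next_start i (pfst r) (psnd r),
     next_value (next_start i (pfst r) (psnd r)) (psnd r)\<rangle>) j"

definition "start j = pfst (plateau j)"
definition "value_at j = psnd (plateau j)"

definition index :: "nat \<Rightarrow> nat" where "index i = (LEAST j. i < start (Suc j))"
definition step :: "nat \<Rightarrow> nat" where "step i = value_at (index i)"

lemma low_ex: "\<exists>m. j \<le> m \<and> j * (v + 2) \<le> l m"
proof -
  obtain n where "j * (v + 2) \<le> l n" using l_unbounded by blast
  also have "l n \<le> l (max j n)" by (rule monoD[OF mono_l]) simp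
  finally show ?thesis by (intro exI[of _ "max j n"]) simp
qed

lemma low: "j \<le> low j v" "j * (v + 2) \<le> l (low j v)"
  using LeastI_ex[OF low_ex[of j v]] by (simp_all add: low_def)

lemma rec_low [rec_intros]:
  assumes "total_recursive f" "total_recursive g"
  shows "total_recursive (\<lambda>n. low (f n) (g n))"
  unfolding low_def
  by (intro rec_Least low_ex) (intro rec_intros rec_comp[OF rec_l] rec_comp[OF assms(1)] rec_comp[OF assms(2)])

lemma rec_plateau: "total_recursive plateau"
  unfolding plateau_def[abs_def] next_start_def next_value_def
  by (intro rec_intros rec_comp[OF rec_l] rec_comp[OF rec_U])

lemma start_0 [simp]: "start 0 = 0"
  and start_Suc: "start (Suc j) = next_start j (start j) (value_at j)"
  and value_0: "value_at 0 = 2"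
  and value_Suc: "value_at (Suc j) = next_value (start (Suc j)) (value_at j)"
  by (simp_all add: start_def value_at_def plateau_def)

lemma start_less: "start j < start (Suc j)"
  by (simp add: start_Suc next_start_def)

lemma strict_mono_start: "strict_mono start"
  by (simp add: strict_mono_Suc_iff start_less)

lemma value_less: "value_at j < value_at (Suc j)"
  by (simp add: value_Suc next_value_def)

lemma strict_mono_value: "strict_mono value_at"
  by (simp add: strict_mono_Suc_iff value_less)

lemma le_start: "j \<le> start j"
  by (rule strict_mono_imp_increasing[OF strict_mono_start])

lemma index_ex: "\<exists>j. i < start (Suc j)"
  using le_start[of "Suc i"] by (auto intro: exI[of _ i])

lemma index_le: "i < start (Suc j) \<Longrightarrow> index i \<le> j"
  unfolding index_def by (rule Least_le)

lemma less_start_index: "i < start (Suc (index i))"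
  unfolding index_def by (rule LeastI_ex[OF index_ex])

lemma mono_index: "mono index"
  by (intro monoI index_le) (use less_start_index le_less_trans in blast)

lemma index_start: "index (start j) = j"
proof (rule antisym)
  show "index (start j) \<le> j" by (rule index_le[OF start_less])
  show "j \<le> index (start j)"
    using less_start_index[of "start j"] strict_mono_less[OF strict_mono_start] by simp
qed

lemma step_le: "i < start (Suc j) \<Longrightarrow> step i \<le> value_at j"
  unfolding step_def by (intro monoD[OF strict_mono_mono[OF strict_mono_value]] index_le)

lemma step_start: "step (start j) = value_at j"
  by (simp add: step_def index_start)

lemma mono_step: "mono step"
  unfolding step_def
  by (intro monoI monoD[OF strict_mono_mono[OF strict_mono_value]] monoD[OF mono_index])

lemma step_ge_2: "2 \<le> step i"
  using monoD[OF strict_mono_mono[OF strict_mono_value], of 0 "index i"] by (simp add: step_def value_0)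

lemma le_step_start: "j \<le> step (start j)"
  unfolding step_start by (rule strict_mono_imp_increasing[OF strict_mono_value])

lemma rec_step: "total_recursive step"
proof -
  have "total_recursive index"
    unfolding index_def[abs_def] start_def
    by (rule rec_Least) (intro rec_intros rec_comp[OF rec_plateau], use index_ex start_def in auto)
  then show ?thesis
    unfolding step_def[abs_def] value_at_def by (intro rec_intros rec_comp[OF rec_plateau])
qed

lemma order_function_step: "order_function (\<lambda>n. real (step n))"
  unfolding order_function_def
proof (intro conjI allI)
  \<comment> \<open>Even codes \<open>2 * a\<close> stand for the integer \<open>a\<close>, so this
    pair is the fraction with denominator 1 and the approximation is exact.\<close>
  have "total_recursive (\<lambda>n. \<langle>2 * step (pfst n), 2\<rangle>)"
    by (intro rec_intros rec_comp[OF rec_step])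
  moreover have "nat_to_rat_surj \<langle>2 * a, 2\<rangle> = of_nat a" for a
  proof -
    have "int_decode (2 * a) = int a" "int_decode 2 = 1"
      by (simp_all add: int_decode_def sum_decode_def)
    then show ?thesis by (simp add: nat_to_rat_surj_def of_int_rat[symmetric])
  qed
  ultimately show "computable_real_function (\<lambda>n. real (step n))"
    unfolding computable_real_function_def by (intro exI conjI allI) auto
  show "mono (\<lambda>n. real (step n))" using mono_step by (auto simp: mono_def)
  show "\<exists>n. M < real (step n)" for M
  proof -
    obtain k where "M < real k" using reals_Archimedean2 by blast
    also have "real k \<le> real (step (start k))" using le_step_start by simp
    finally show ?thesis ..
  qed
qed

text \<open>Each plateau is at least as long as its value, so it contributes at least 1 to the
  sum.\<close>

lemma slow_growing_step: "slow_growing (\<lambda>n. real (step n))"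
  unfolding slow_growing_def filterlim_at_top
proof
  fix Z :: real
  define S where "S N = (\<Sum>n<N. inverse (real (step n)))" for N
  have ge: "real j \<le> S (start j)" for j
  proof (induction j)
    case (Suc j)
    have "1 \<le> real (start (Suc j) - start j) * inverse (real (value_at j))"
    proof -
      have "value_at j \<le> start (Suc j) - start j" by (simp add: start_Suc next_start_def)
      moreover have "0 < value_at j" using step_ge_2[of "start j"] by (simp add: step_start)
      ultimately show ?thesis by (simp add: field_simps)
    qed
    also have "\<dots> = (\<Sum>n\<in>{start j..<start (Suc j)}. inverse (real (value_at j)))" by simp
    also have "\<dots> \<le> (\<Sum>n\<in>{start j..<start (Suc j)}. inverse (real (step n)))"
    proof (rule sum_mono)
      fix n assume "n \<in> {start j..<start (Suc j)}"
      then have "step n \<le> value_at j" by (intro step_le) simp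
      then show "inverse (real (value_at j)) \<le> inverse (real (step n))"
        using step_ge_2[of n] by (intro le_imp_inverse_le) auto
    qed
    finally have "1 + S (start j) \<le> S (start j) + (\<Sum>n\<in>{start j..<start (Suc j)}. inverse (real (step n)))"
      by simp
    also have "\<dots> = S (start (Suc j))"
      unfolding S_def lessThan_atLeast0 using start_less[of j] by (intro sum.atLeastLessThan_concat) auto
    finally show ?case using Suc by simp
  qed (simp add: S_def)
  obtain j where j: "Z \<le> real j" using real_arch_simple by blast
  have "Z \<le> S N" if "start j \<le> N" for N
  proof -
    have "S (start j) \<le> S N" unfolding S_def by (rule sum_mono2) (use that in auto)
    with j ge[of j] show ?thesis by linarith
  qed
  then show "\<forall>\<^sub>F N in sequentially. Z \<le> (\<Sum>n<N. inverse (real (step n)))"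
    unfolding S_def eventually_sequentially by blast
qed

text \<open>The room is at the start of a plateau: strings of that length only involve earlier,
  smaller values, while the level itself already has the new value.\<close>

lemma step_not_reducible:
  assumes p: "mono p" "\<And>n. p n \<le> real (U n)"
  shows "\<not> LUA p \<le>\<^sub>w LUA (\<lambda>n. real (step n))"
proof (rule not_weakly_reducible_LUA[of step])
  show "total_recursive step" "mono step" "0 < step n" for n
    using rec_step mono_step step_ge_2[of n] by simp_all
  show "real (step n) \<le> real (step n)" for n ..
  \<comment> \<open>The ceiling inherits monotonicity from \<open>p\<close>, whereas
    \<open>U\<close> is only known to bound \<open>p\<close> pointwise.\<close>
  show "p n \<le> real (nat \<lceil>p n\<rceil>)" for n by linarith
  fix K
  define m where "m = start (Suc K)"
  have "K \<le> m" using le_start[of "Suc K"] by (simp add: m_def)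
  moreover have "k * (nat \<lceil>p (a * req_code c a b k \<sigma> + b)\<rceil> + 2) \<le> step m"
    if \<sigma>: "bounded_string step \<sigma>" "length \<sigma> = m" and le: "c \<le> K" "a \<le> K" "b \<le> K" "k \<le> K" for \<sigma> c a b k
  proof -
    let ?x = "a * req_code c a b k \<sigma> + b" and ?y = "code_bound m m (value_at K)"
    have "?x \<le> code_bound m (length \<sigma>) (value_at K)"
    proof (rule req_code_bound[OF \<sigma>(1)])
      show "step i \<le> value_at K" if "i < length \<sigma>" for i
        using that \<sigma>(2) by (intro step_le) (simp add: m_def)
    qed (use le \<open>K \<le> m\<close> in simp_all)
    then have "p ?x \<le> p ?y" using \<sigma>(2) by (intro monoD[OF p(1)]) simp
    also have "\<dots> \<le> real (U ?y)" by (rule p(2))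
    finally have "nat \<lceil>p ?x\<rceil> + 2 \<le> U ?y + 2" by linarith
    then have "k * (nat \<lceil>p ?x\<rceil> + 2) \<le> m * (U ?y + 2)"
      using le(4) \<open>K \<le> m\<close> by (intro mult_le_mono) simp_all
    also have "\<dots> \<le> step m" by (simp add: m_def step_start value_Suc next_value_def)
    finally show ?thesis .
  qed
  ultimately show "\<exists>m\<ge>K. \<forall>\<sigma> c a b k. bounded_string step \<sigma> \<longrightarrow> length \<sigma> = m \<longrightarrow>
      c \<le> K \<longrightarrow> a \<le> K \<longrightarrow> b \<le> K \<longrightarrow> k \<le> K \<longrightarrow>
      k * (nat \<lceil>p (a * req_code c a b k \<sigma> + b)\<rceil> + 2) \<le> step m"
    by (intro exI[of _ m]) simp
qed

text \<open>Positions attacked from level \<open>low K (value_at K)\<close> come before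
  \<open>start (Suc K)\<close>, where the step function is still at most
  \<open>value_at K\<close>.\<close>

lemma not_reducible_step:
  assumes p: "\<And>n. real (l n) \<le> p n" and pos: "\<And>n. 0 < l n"
  shows "\<not> LUA (\<lambda>n. real (step n)) \<le>\<^sub>w LUA p"
proof (rule not_weakly_reducible_LUA[OF rec_l mono_l pos p])
  show "real (step n) \<le> real (step n)" for n ..
  fix K
  define m where "m = low K (value_at K)"
  have "k * (step (a * req_code c a b k \<sigma> + b) + 2) \<le> l m"
    if \<sigma>: "bounded_string l \<sigma>" "length \<sigma> = m" and le: "c \<le> K" "a \<le> K" "b \<le> K" "k \<le> K" for \<sigma> c a b k
  proof -
    have "a * req_code c a b k \<sigma> + b \<le> code_bound K (length \<sigma>) (l m)"
    proof (rule req_code_bound[OF \<sigma>(1) _ le])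
      show "l i \<le> l m" if "i < length \<sigma>" for i
        using that \<sigma>(2) by (intro monoD[OF mono_l]) simp
    qed
    also have "\<dots> < start (Suc K)" by (simp add: \<sigma>(2) m_def start_Suc next_start_def)
    finally have "step (a * req_code c a b k \<sigma> + b) \<le> value_at K" by (rule step_le)
    then have "k * (step (a * req_code c a b k \<sigma> + b) + 2) \<le> K * (value_at K + 2)"
      using le(4) by (intro mult_le_mono) simp_all
    also have "\<dots> \<le> l m" unfolding m_def by (rule low)
    finally show ?thesis .
  qed
  moreover have "K \<le> m" unfolding m_def by (rule low)
  ultimately show "\<exists>m\<ge>K. \<forall>\<sigma> c a b k. bounded_string l \<sigma> \<longrightarrow> length \<sigma> = m \<longrightarrow>
      c \<le> K \<longrightarrow> a \<le> K \<longrightarrow> b \<le> K \<longrightarrow> k \<le> K \<longrightarrow> k * (step (a * req_code c a b k \<sigma> + b) + 2) \<le> l m"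
    by (intro exI[of _ m]) simp
qed

end

section \<open>Recursive integer bounds for order functions\<close>

lemma abs_int_decode: "\<bar>int_decode n\<bar> = int (Suc n div 2)"
  by (auto simp: int_decode_def sum_decode_def elim!: evenE oddE)

lemma computable_rational_approximation:
  assumes "computable_real_function p"
  obtains a b where "total_recursive a" "total_recursive b"
    "\<And>n. \<bar>p n - of_int (int_decode (a n)) / of_int (int_decode (b n))\<bar> \<le> 1"
proof -
  obtain f where f: "total_recursive f"
    "\<And>n k. \<bar>p n - of_rat (nat_to_rat_surj (f \<langle>n, k\<rangle>))\<bar> \<le> 1 / 2 ^ k"
    using assms unfolding computable_real_function_def by blast
  have "(of_rat (nat_to_rat_surj x) :: real) =
      of_int (int_decode (pfst x)) / of_int (int_decode (psnd x))" for x
    by (simp add: nat_to_rat_surj_def pfst_def psnd_def case_prod_unfold Let_def Fract_of_int_quotient of_rat_divide)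
  then have "\<bar>p n - of_int (int_decode (pfst (f \<langle>n, 0\<rangle>))) / of_int (int_decode (psnd (f \<langle>n, 0\<rangle>)))\<bar> \<le> 1" for n
    using f(2)[of n 0] by simp
  moreover have "total_recursive (\<lambda>n. pfst (f \<langle>n, 0\<rangle>))" "total_recursive (\<lambda>n. psnd (f \<langle>n, 0\<rangle>))"
    by (intro rec_intros rec_comp[OF f(1)])+
  ultimately show ?thesis using that by blast
qed

lemma recursive_upper_bound:
  assumes "computable_real_function p"
  obtains U where "total_recursive U" "\<And>n. p n \<le> real (U n)"
proof -
  obtain a b where ab: "total_recursive a" "total_recursive b"
    "\<And>n. \<bar>p n - of_int (int_decode (a n)) / of_int (int_decode (b n))\<bar> \<le> 1"
    using computable_rational_approximation[OF assms] by metis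
  have "p n \<le> real (a n + 2)" for n
  proof -
    \<comment> \<open>Dividing by a nonzero integer does not increase the absolute value, and
      division by 0 yields 0, so the numerator alone gives a bound.\<close>
    have "\<bar>of_int A / of_int B\<bar> \<le> \<bar>of_int A :: real\<bar>" for A B :: int
    proof (cases "B = 0")
      case False
      then have "1 \<le> \<bar>of_int B :: real\<bar>" by linarith
      then have "\<bar>of_int A\<bar> * 1 \<le> \<bar>of_int A :: real\<bar> * \<bar>of_int B\<bar>" by (rule mult_left_mono) simp
      with False show ?thesis by (simp add: abs_divide divide_le_eq)
    qed simp
    from this[of "int_decode (a n)" "int_decode (b n)"]
    have "\<bar>of_int (int_decode (a n)) / of_int (int_decode (b n)) :: real\<bar> \<le> real (Suc (a n) div 2)"
      by (metis abs_int_decode of_int_abs of_int_of_nat_eq)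
    moreover have "real (Suc (a n) div 2) \<le> real (a n + 1)" by simp
    ultimately show ?thesis using ab(3)[of n] by linarith
  qed
  moreover have "total_recursive (\<lambda>n. a n + 2)" by (intro rec_intros ab(1))
  ultimately show ?thesis using that by blast
qed

lemma recursive_lower_bound:
  assumes "order_function p" "\<And>n. 1 < p n"
  obtains l where "total_recursive l" "mono l" "\<And>M. \<exists>n. M \<le> l n" "\<And>n. real (l n) \<le> p n" "\<And>n. 0 < l n"
proof -
  obtain a b where ab: "total_recursive a" "total_recursive b"
    "\<And>n. \<bar>p n - of_int (int_decode (a n)) / of_int (int_decode (b n))\<bar> \<le> 1"
    using computable_rational_approximation assms(1) unfolding order_function_def by metis
  define d where "d n = (Suc (a n) div 2) div (Suc (b n) div 2)" for n
  have rec_d: "total_recursive d" unfolding d_def[abs_def] by (intro rec_intros ab)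
  have d: "real (d n) \<le> p n + 1" "p n \<le> real (d n) + 2" for n
  proof -
    let ?A = "of_int (int_decode (a n)) :: real" and ?B = "of_int (int_decode (b n)) :: real"
    have abs: "\<bar>?A\<bar> = real (Suc (a n) div 2)" "\<bar>?B\<bar> = real (Suc (b n) div 2)"
      by (metis abs_int_decode of_int_abs of_int_of_nat_eq)+
    have near: "\<bar>p n - ?A / ?B\<bar> \<le> 1" by (rule ab(3))
    \<comment> \<open>As \<open>p n > 1\<close> and the error is at most 1, the quotient is
      positive, so signs may be dropped.\<close>
    with assms(2)[of n] have "?A / ?B = \<bar>?A\<bar> / \<bar>?B\<bar>" by (simp flip: abs_divide)
    then have eq: "?A / ?B = real (Suc (a n) div 2) / real (Suc (b n) div 2)" unfolding abs .
    have "real (d n) \<le> ?A / ?B" unfolding d_def eq by (rule of_nat_div_le_of_nat)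
    with near show "real (d n) \<le> p n + 1" by linarith
    have "?A / ?B - real (d n) \<le> 1" unfolding d_def eq
      using floor_divide_of_nat_eq[where 'a = real, of "Suc (a n) div 2" "Suc (b n) div 2"] by linarith
    with near show "p n \<le> real (d n) + 2" by linarith
  qed
  \<comment> \<open>The running maximum of 1 and all \<open>d i - 1\<close> with
    \<open>i < n\<close>: monotone and positive by construction, and below \<open>p n\<close>
    because \<open>p\<close> is monotone.\<close>
  define l where "l n = rec_nat 1 (\<lambda>i r. if r < d i - 1 then d i - 1 else r) n" for n
  have "total_recursive l"
    unfolding l_def[abs_def] by (intro rec_intros rec_comp[OF rec_d])
  moreover have l_Suc: "l (Suc n) = max (l n) (d n - 1)" for n by (simp add: l_def max_def)
  moreover have "mono l" by (rule incseq_SucI) (simp add: l_Suc)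
  moreover have "0 < l n" for n
  proof (induction n)
    case (Suc n)
    then show ?case by (simp add: l_Suc less_max_iff_disj)
  qed (simp add: l_def)
  moreover have "real (l n) \<le> p n" for n
  proof (induction n)
    case 0
    show ?case using assms(2)[of 0] by (simp add: l_def)
  next
    case (Suc n)
    have "p n \<le> p (Suc n)" using assms(1) by (simp add: order_function_def mono_def)
    moreover have "real (d n - 1) \<le> p n" using d(1)[of n] assms(2)[of n] by linarith
    ultimately show ?case using Suc by (simp add: l_Suc max_def)
  qed
  moreover have "\<exists>n. M \<le> l n" for M
  proof -
    obtain n where "real M + 3 < p n" using assms(1) unfolding order_function_def by blast
    with d(2)[of n] have "M \<le> d n - 1" by linarith
    then have "M \<le> l (Suc n)" by (simp add: l_Suc)
    then show ?thesis ..
  qed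
  ultimately show ?thesis using that by blast
qed

section \<open>Application to arbitrary order functions\<close>

theorem slow_growing_between:
  assumes "order_function p1" "order_function p2" "\<And>n. 1 < p2 n"
  shows "\<exists>q. order_function q \<and> (\<forall>n. 1 < q n) \<and> slow_growing q \<and>
    \<not> LUA p1 \<le>\<^sub>w LUA q \<and> \<not> LUA q \<le>\<^sub>w LUA p2"
proof -
  obtain U where U: "total_recursive U" "\<And>n. p1 n \<le> real (U n)"
    using recursive_upper_bound assms(1) unfolding order_function_def by metis
  obtain l where l: "total_recursive l" "mono l" "\<And>M. \<exists>n. M \<le> l n" "\<And>n. real (l n) \<le> p2 n"
    "\<And>n. 0 < l n"
    using recursive_lower_bound[OF assms(2,3)] by metis
  interpret step_function l U by unfold_locales (fact l U)+
  have "1 < real (step n)" for n using step_ge_2[of n] by simp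
  moreover have "mono p1" using assms(1) by (simp add: order_function_def)
  ultimately show ?thesis
    using order_function_step slow_growing_step step_not_reducible[OF _ U(2)] not_reducible_step[OF l(4,5)]
    by blast
qed

theorem mainTheorem6:
  shows "(\<forall>p1 p2 :: nat \<Rightarrow> real.
            order_function p1 \<and> (\<forall>n. 1 < p1 n) \<and> order_function p2 \<and> (\<forall>n. 1 < p2 n) \<longrightarrow>
            (\<exists>q :: nat \<Rightarrow> real. order_function q \<and> (\<forall>n. 1 < q n) \<and> slow_growing q \<and>
               \<not> LUA p1 \<le>\<^sub>w LUA q \<and> \<not> LUA q \<le>\<^sub>w LUA p2))
       \<and> (\<forall>p :: nat \<Rightarrow> real.
            order_function p \<and> (\<forall>n. 1 < p n) \<longrightarrow>
            (\<exists>q :: nat \<Rightarrow> real. order_function q \<and> (\<forall>n. 1 < q n) \<and> slow_growing q \<and>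
               \<not> LUA p \<le>\<^sub>w LUA q \<and> \<not> LUA q \<le>\<^sub>w LUA p))"
  \<comment> \<open>The second conjunct is the case where both given order functions are
    \<open>p\<close>.\<close>
  using slow_growing_between by blast

end
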